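(* Let $\Bbbk$ be a field, let $R=\Bbbk[x,y]$, and let $(C_n,\alpha_n)$ be an edge-labeled $n$-cycle, each of whose edges is labeled by a principal ideal of the form $\langle (x+ay)^2\rangle$ with $0\neq a\in\Bbbk$, with three or more distinct (not necessarily successive) edge-labels. The following algorithm constructs a homogeneous minimum generating set $\mathcal{B}_n$ for $R_{C_n,\alpha_n}$. (1) Let $C_{n-k}$ be the reduced cycle, with edge-labeling $\alpha_{n-k}$, obtained from $C_n$ by eliminating vertices whose incident edges have the same label: successively, if $v$ has neighbors $u,w$ in the current cycle and the edges $uv$, $vw$ have the same label $I$, replace $v$ and these two edges by a single edge $uw$ labeled $I$, until no such vertex remains; $k$ is the number of eliminated vertices. Write $m=n-k$. (2) Let $\mathcal{B}_m$ be the following homogeneous minimum generating set for $R_{C_m,\alpha_m}$. Order the vertices $v_0,v_1,\dots,v_m=v_0$ clockwise around $C_m$ such that $\alpha_m(v_{i-1}v_i)=\langle\mathsf{a}_i\rangle$, $\mathsf{a}_i=(x+a_iy)^2$, and $a_{m-1},a_m,a_1$ are all distinct. For $1<i\le m-2$ let $a_{i,m-1},a_{i,m},a_{i,1}\in\Bbbk$ be the elements with $\mathsf{a}_i=a_{i,m-1}\mathsf{a}_{m-1}+a_{i,m}\mathsf{a}_m+a_{i,1}\mathsf{a}_1$, and define $\mathbf{b}^i$ (for $1\le j\le m$) by $\mathbf{b}^i_{v_j}=0$ if $j<i$, $\mathbf{b}^i_{v_j}=\mathsf{a}_i$ if $i\le j\le m-2$, $\mathbf{b}^i_{v_{m-1}}=\mathsf{a}_i-a_{i,m-1}\mathsf{a}_{m-1}$,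 and $\mathbf{b}^i_{v_m}=\mathsf{a}_i-a_{i,m-1}\mathsf{a}_{m-1}-a_{i,m}\mathsf{a}_m$. Let $f_1,f_2,g_1,g_2\in\Bbbk[x,y]$ be the homogeneous degree-one polynomials with $x\mathsf{a}_{m-1}=f_1\mathsf{a}_m+g_1\mathsf{a}_1$ and $y\mathsf{a}_{m-1}=f_2\mathsf{a}_m+g_2\mathsf{a}_1$. Define $\mathbf{b}^{m-1}$ to be $0$ at $v_j$ for $1\le j\le m-2$, $x\mathsf{a}_{m-1}$ at $v_{m-1}$ and $g_1\mathsf{a}_1$ at $v_m$; define $\mathbf{b}^{m}$ to be $0$ at $v_j$ for $1\le j\le m-2$, $y\mathsf{a}_{m-1}$ at $v_{m-1}$ and $g_2\mathsf{a}_1$ at $v_m$. Set $\mathcal{B}_m=\{\mathbf{1},\mathbf{b}^2,\dots,\mathbf{b}^m\}$. (3) Create $\mathcal{B}_n$ from $\mathcal{B}_m=\mathcal{B}_{n-k}$ by successively reinserting the vertices on repeated edges, in the reverse order of elimination: when a vertex $v$ is reinserted into an edge $uw$ labeled $\langle\mathsf{s}\rangle$, where $\mathsf{s}=(x+ay)^2$ (so that $uv$ and $vw$ are again labeled $\langle\mathsf{s}\rangle$), fix $u'\in\{u,w\}$, extend each spline $\mathbf{b}$ of the current set to $v$ by $\mathbf{b}_v:=\mathbf{b}_{u'}$, and adjoin to the set the spline that equals $\mathsf{s}$ at $v$ and $0$ at all other vertices.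
   Context: An edge-labeling of a graph $G=(V,E)$ is a function $\alpha$ from $E$ to the set of ideals of $R$. A (generalized) spline on $(G,\alpha)$ is a vector $\mathbf{p}\in\bigoplus_{v\in V}R$ with $\mathbf{p}_u-\mathbf{p}_v\in\alpha(uv)$ for every edge $uv\in E$; the set $R_{G,\alpha}$ of splines is an $R$-module under coordinatewise operations. The trivial spline $\mathbf{1}$ has $\mathbf{1}_v=1$ for all $v$. A minimum generating set (MGS) is a generating set of the $R$-module $R_{G,\alpha}$ such that no other generating set has fewer elements. An MGS is homogeneous if for each of its elements $\mathbf{b}$ all nonzero entries of $\mathbf{b}$ are homogeneous polynomials of one and the same degree. An edge-labeled graph is reduced if no two edges incident to the same vertex have the same edge-label.
   Formalization: The field is assumed to have characteristic different from 2; in characteristic 2 any three squares (x+ay)^2 are linearly dependent and the constructed set never generates the module of splines. *)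

theory Defs
  imports
    "HOL-Computational_Algebra.Polynomial"
    "HOL-Library.Function_Algebras"
    "HOL-Library.Equipollence"
begin

section \<open>Edge-labeled graphs and splines\<close>

text \<open>
  Edges are unordered pairs \<open>{u, v}\<close>, and a label is the ideal as a set of ring elements.
  Only the values of \<open>label\<close> on \<open>edges\<close> matter.
\<close>

record ('v, 'r) labeled_graph =
  verts :: "'v set"
  edges :: "'v set set"
  label :: "'v set \<Rightarrow> 'r set"

text \<open>
  Not an interpretation: its simplification rules would reassociate products against \<open>mult.assoc\<close>.
\<close>

lemma ring_module: "module ((*) :: 'r::comm_ring_1 \<Rightarrow> 'r \<Rightarrow> 'r)"
  by unfold_locales (simp_all add: algebra_simps)

definition principal_ideal :: "'r::comm_ring_1 \<Rightarrow> 'r set" where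
  "principal_ideal s = module.span (*) {s}"

definition scale_coordwise :: "'r::comm_ring_1 \<Rightarrow> ('v \<Rightarrow> 'r) \<Rightarrow> 'v \<Rightarrow> 'r" where
  "scale_coordwise r p = (\<lambda>v. r * p v)"

global_interpretation coordwise: module "scale_coordwise :: 'r::comm_ring_1 \<Rightarrow> ('v \<Rightarrow> 'r) \<Rightarrow> _"
proof unfold_locales
qed (simp_all add: scale_coordwise_def fun_eq_iff distrib_left distrib_right mult.assoc)

text \<open>
  A vector indexed by the vertices is a function that vanishes outside \<open>verts G\<close>.
\<close>

definition splines :: "('v, 'r::comm_ring_1) labeled_graph \<Rightarrow> ('v \<Rightarrow> 'r) set" where
  "splines G = {p. (\<forall>v. v \<notin> verts G \<longrightarrow> p v = 0) \<and>
                   (\<forall>u v. {u, v} \<in> edges G \<longrightarrow> p u - p v \<in> label G {u, v})}"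

lemma subspace_splines:
  assumes "\<And>e. e \<in> edges G \<Longrightarrow> module.subspace (*) (label G e)"
  shows "coordwise.subspace (splines G)"
proof (rule coordwise.subspaceI)
  show "0 \<in> splines G"
    using assms by (auto simp: splines_def module.subspace_0[OF ring_module])
next
  fix p q assume pq: "p \<in> splines G" "q \<in> splines G"
  have "(p u + q u) - (p v + q v) \<in> label G {u, v}" if e: "{u, v} \<in> edges G" for u v
  proof -
    have "(p u - p v) + (q u - q v) \<in> label G {u, v}"
      using pq e by (intro module.subspace_add[OF ring_module] assms) (simp_all add: splines_def)
    then show ?thesis by (simp only: add_diff_add)
  qed
  then show "p + q \<in> splines G"
    using pq by (simp add: splines_def)
next
  fix r p assume p: "p \<in> splines G"
  have "r * p u - r * p v \<in> label G {u, v}" if e: "{u, v} \<in> edges G" for u v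
  proof -
    have "r * (p u - p v) \<in> label G {u, v}"
      using p e by (intro module.subspace_scale[OF ring_module] assms) (simp_all add: splines_def)
    then show ?thesis by (simp only: right_diff_distrib)
  qed
  then show "scale_coordwise r p \<in> splines G"
    using p by (simp add: splines_def scale_coordwise_def)
qed

definition trivial_spline :: "('v, 'r::comm_ring_1) labeled_graph \<Rightarrow> 'v \<Rightarrow> 'r" where
  "trivial_spline G = (\<lambda>v. if v \<in> verts G then 1 else 0)"

definition generates_splines :: "('v, 'r::comm_ring_1) labeled_graph \<Rightarrow> ('v \<Rightarrow> 'r) set \<Rightarrow> bool" where
  "generates_splines G B \<longleftrightarrow> B \<subseteq> splines G \<and> coordwise.span B = splines G"

definition min_generating_set :: "('v, 'r::comm_ring_1) labeled_graph \<Rightarrow> ('v \<Rightarrow> 'r) set \<Rightarrow> bool" where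
  "min_generating_set G B \<longleftrightarrow>
     generates_splines G B \<and> (\<forall>B'. generates_splines G B' \<longrightarrow> \<not> B' \<prec> B)"

definition reduced :: "('v, 'r) labeled_graph \<Rightarrow> bool" where
  "reduced G \<longleftrightarrow>
     (\<forall>e \<in> edges G. \<forall>e' \<in> edges G. e \<noteq> e' \<and> e \<inter> e' \<noteq> {} \<longrightarrow> label G e \<noteq> label G e')"


section \<open>Cycles and elimination of vertices\<close>

text \<open>
  An enumeration \<open>v 0, v 1, \<dots>, v n = v 0\<close> of the vertices around a cycle; an abstract
  cycle has no preferred orientation, so both directions are allowed.
\<close>

definition cyclic_order :: "nat \<Rightarrow> ('v, 'r) labeled_graph \<Rightarrow> (nat \<Rightarrow> 'v) \<Rightarrow> bool" where
  "cyclic_order n G v \<longleftrightarrow> v 0 = v n \<and> bij_betw v {1..n} (verts G) \<and>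
     edges G = (\<lambda>i. {v (i - 1), v i}) ` {1..n}"

definition is_cycle :: "nat \<Rightarrow> ('v, 'r) labeled_graph \<Rightarrow> bool" where
  "is_cycle n G \<longleftrightarrow> 3 \<le> n \<and> (\<exists>v. cyclic_order n G v)"

text \<open>
  \<open>eliminates G v u w I G'\<close>: the vertex \<open>v\<close> with neighbors \<open>u\<close>, \<open>w\<close> and equal incident labels \<open>I\<close>
  is removed. On a 3-cycle \<open>{u, w}\<close> is already an edge, but there two equal labels leave at most
  two distinct ones, so this case does not arise for cycles with at least three distinct labels.
\<close>

definition eliminates ::
    "('v, 'r) labeled_graph \<Rightarrow> 'v \<Rightarrow> 'v \<Rightarrow> 'v \<Rightarrow> 'r set \<Rightarrow> ('v, 'r) labeled_graph \<Rightarrow> bool" where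
  "eliminates G v u w I G' \<longleftrightarrow>
     u \<noteq> w \<and> {u, v} \<in> edges G \<and> {v, w} \<in> edges G \<and> label G {u, v} = I \<and> label G {v, w} = I \<and>
     G' = \<lparr>verts = verts G - {v},
           edges = insert {u, w} (edges G - {{u, v}, {v, w}}),
           label = (label G)({u, w} := I)\<rparr>"

inductive eliminations ::
    "('v, 'r) labeled_graph \<Rightarrow> ('v \<times> 'v \<times> 'v \<times> 'r set) list \<Rightarrow> ('v, 'r) labeled_graph \<Rightarrow> bool" where
  "eliminations G [] G"
| "eliminates G v u w I G' \<Longrightarrow> eliminations G' es G'' \<Longrightarrow> eliminations G ((v, u, w, I) # es) G''"


section \<open>Two-variable polynomials\<close>

text \<open>
  \<open>k[x,y]\<close> is \<open>k[x][y]\<close>: the coefficient of \<open>x\<^sup>i y\<^sup>j\<close> in \<open>p\<close> is \<open>coeff (coeff p j) i\<close>.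
\<close>

definition var_x :: "'k::comm_ring_1 poly poly" where "var_x = [:[:0, 1:]:]"

definition var_y :: "'k::comm_ring_1 poly poly" where "var_y = [:0, 1:]"

definition const2 :: "'k::comm_ring_1 \<Rightarrow> 'k poly poly" where "const2 c = [:[:c:]:]"

text \<open>
  In characteristic 2 all these squares lie in the span of \<open>x\<^sup>2\<close> and \<open>y\<^sup>2\<close>, so three of them are
  linearly dependent. A reduced 3-cycle then has a spline of degree 2 vanishing at the first vertex
  that the set below, with its generators of degree 3, does not generate.
\<close>

definition sq_form :: "'k::comm_ring_1 \<Rightarrow> 'k poly poly" where
  "sq_form a = (var_x + const2 a * var_y) ^ 2"

text \<open>The zero polynomial counts as homogeneous of every degree.\<close>

definition homogeneous :: "nat \<Rightarrow> 'k::comm_ring_1 poly poly \<Rightarrow> bool" where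
  "homogeneous d p \<longleftrightarrow> (\<forall>i j. coeff (coeff p j) i \<noteq> 0 \<longrightarrow> i + j = d)"

definition homogeneous_mgs ::
    "('v, 'k::comm_ring_1 poly poly) labeled_graph \<Rightarrow> ('v \<Rightarrow> 'k poly poly) set \<Rightarrow> bool" where
  "homogeneous_mgs G B \<longleftrightarrow> min_generating_set G B \<and>
     (\<forall>b \<in> B. \<exists>d. \<forall>v \<in> verts G. b v \<noteq> 0 \<longrightarrow> homogeneous d (b v))"


section \<open>The generating set of a reduced cycle\<close>

definition good_order ::
    "nat \<Rightarrow> ('v, 'k::comm_ring_1 poly poly) labeled_graph \<Rightarrow> (nat \<Rightarrow> 'v) \<Rightarrow> (nat \<Rightarrow> 'k) \<Rightarrow> bool" where
  "good_order m G v a \<longleftrightarrow> cyclic_order m G v \<and>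
     (\<forall>i \<in> {1..m}. label G {v (i - 1), v i} = principal_ideal (sq_form (a i))) \<and>
     distinct [a (m - 1), a m, a 1]"

text \<open>
  \<open>c i j\<close>, with \<open>j\<close> one of \<open>m - 1\<close>, \<open>m\<close>, \<open>1\<close>, are the scalars expressing \<open>sq_form (a i)\<close> through the
  forms \<open>m - 1\<close>, \<open>m\<close> and \<open>1\<close>; \<open>f 1, g 1\<close> and \<open>f 2, g 2\<close> are the linear forms that express
  \<open>x\<close> and \<open>y\<close> times form \<open>m - 1\<close> through forms \<open>m\<close> and \<open>1\<close>.
\<close>

definition good_coeffs ::
    "nat \<Rightarrow> (nat \<Rightarrow> 'k::comm_ring_1) \<Rightarrow> (nat \<Rightarrow> nat \<Rightarrow> 'k) \<Rightarrow>
     (nat \<Rightarrow> 'k poly poly) \<Rightarrow> (nat \<Rightarrow> 'k poly poly) \<Rightarrow> bool" where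
  "good_coeffs m a c f g \<longleftrightarrow>
     (\<forall>i. 1 < i \<and> i \<le> m - 2 \<longrightarrow>
        sq_form (a i) = const2 (c i (m - 1)) * sq_form (a (m - 1))
          + const2 (c i m) * sq_form (a m) + const2 (c i 1) * sq_form (a 1)) \<and>
     homogeneous 1 (f 1) \<and> homogeneous 1 (g 1) \<and> homogeneous 1 (f 2) \<and> homogeneous 1 (g 2) \<and>
     var_x * sq_form (a (m - 1)) = f 1 * sq_form (a m) + g 1 * sq_form (a 1) \<and>
     var_y * sq_form (a (m - 1)) = f 2 * sq_form (a m) + g 2 * sq_form (a 1)"

text \<open>The vector whose entry at \<open>v j\<close> is \<open>h j\<close> for \<open>1 \<le> j \<le> m\<close> (for \<open>v\<close> injective on \<open>{1..m}\<close>).\<close>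

definition vertex_vector :: "nat \<Rightarrow> (nat \<Rightarrow> 'v) \<Rightarrow> (nat \<Rightarrow> 'r::comm_ring_1) \<Rightarrow> 'v \<Rightarrow> 'r" where
  "vertex_vector m v h = (\<lambda>z. \<Sum>j | j \<in> {1..m} \<and> v j = z. h j)"

definition low_spline ::
    "nat \<Rightarrow> (nat \<Rightarrow> 'v) \<Rightarrow> (nat \<Rightarrow> 'k::comm_ring_1) \<Rightarrow> (nat \<Rightarrow> nat \<Rightarrow> 'k) \<Rightarrow> nat \<Rightarrow> 'v \<Rightarrow> 'k poly poly" where
  "low_spline m v a c i = vertex_vector m v (\<lambda>j.
     if j < i then 0
     else if j \<le> m - 2 then sq_form (a i)
     else if j = m - 1 then sq_form (a i) - const2 (c i (m - 1)) * sq_form (a (m - 1))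
     else sq_form (a i) - const2 (c i (m - 1)) * sq_form (a (m - 1)) - const2 (c i m) * sq_form (a m))"

definition high_spline ::
    "nat \<Rightarrow> (nat \<Rightarrow> 'v) \<Rightarrow> (nat \<Rightarrow> 'k::comm_ring_1) \<Rightarrow> 'k poly poly \<Rightarrow> 'k poly poly \<Rightarrow> 'v \<Rightarrow> 'k poly poly" where
  "high_spline m v a t h = vertex_vector m v (\<lambda>j.
     if j \<le> m - 2 then 0
     else if j = m - 1 then t * sq_form (a (m - 1))
     else h * sq_form (a 1))"

definition reduced_mgs ::
    "nat \<Rightarrow> ('v, 'k::comm_ring_1 poly poly) labeled_graph \<Rightarrow> (nat \<Rightarrow> 'v) \<Rightarrow> (nat \<Rightarrow> 'k) \<Rightarrow>
     (nat \<Rightarrow> nat \<Rightarrow> 'k) \<Rightarrow> (nat \<Rightarrow> 'k poly poly) \<Rightarrow> ('v \<Rightarrow> 'k poly poly) set" where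
  "reduced_mgs m G v a c g =
     {trivial_spline G} \<union> {low_spline m v a c i | i. 1 < i \<and> i \<le> m - 2} \<union>
     {high_spline m v a var_x (g 1), high_spline m v a var_y (g 2)}"


section \<open>Reinsertion of vertices\<close>

text \<open>
  \<open>reinsertions es B\<^sub>0 B\<close>: undoing the eliminations \<open>es\<close> turns \<open>B\<^sub>0\<close> into \<open>B\<close>. The head of \<open>es\<close> is
  the vertex eliminated first, hence the one reinserted last.
\<close>

inductive reinsertions ::
    "('v \<times> 'v \<times> 'v \<times> 'k::comm_ring_1 poly poly set) list \<Rightarrow>
     ('v \<Rightarrow> 'k poly poly) set \<Rightarrow> ('v \<Rightarrow> 'k poly poly) set \<Rightarrow> bool" where
  "reinsertions [] B B"
| "reinsertions es B\<^sub>0 B \<Longrightarrow> u' \<in> {u, w} \<Longrightarrow> I = principal_ideal (sq_form a) \<Longrightarrow>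
   reinsertions ((v, u, w, I) # es) B\<^sub>0
     (insert (\<lambda>z. if z = v then sq_form a else 0) ((\<lambda>b. b(v := b u')) ` B))"

end

theory Submission
  imports Defs "HOL-Computational_Algebra.Polynomial_Factorial"
begin

text \<open>
  The splines of a cycle contain a nonzero multiple of every unit vector, so over the fraction
  field they span a space whose dimension is the number of vertices. A generating set with at most
  that many elements is therefore minimal, and only generation has to be checked.

  Write \<open>A i\<close> for \<open>(x + a i * y)\<^sup>2\<close>. On a reduced cycle the low splines successively clear the
  entries at \<open>v 1, \<dots>, v (m - 2)\<close>. In what remains, the entry at \<open>v (m - 1)\<close> is \<open>r * A (m - 1)\<close> with \<open>r * A (m - 1)\<close> in the ideal of
  \<open>A m\<close> and \<open>A 1\<close>; the three squares are linearly independent in characteristic other than 2, so \<open>r\<close>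
  lies in \<open>(x, y)\<close> and the two high splines clear that entry. The last entry is then a multiple of
  \<open>A m * A 1\<close>, and \<open>y\<close> times the first high spline minus \<open>x\<close> times the second is a nonzero constant
  multiple of \<open>A m * A 1\<close> at \<open>v m\<close> and zero elsewhere.

  A spline of the larger cycle is determined by its restriction, up to a multiple of the label at
  the reinserted vertex, so one reinsertion needs one more generator.
\<close>

section \<open>Squares of linear forms in two variables\<close>

lemma dvdE_right:
  fixes d x :: "'r::comm_ring_1"
  assumes "d dvd x"
  obtains s where "x = s * d"
  using assms by (auto simp: dvd_def mult.commute)

lemma dvd_diff_swap: "d dvd x - y \<Longrightarrow> d dvd y - x"
  for x y :: "'r::comm_ring_1"
  by (metis dvd_minus_iff minus_diff_eq)

lemma mem_principal_ideal: "x \<in> principal_ideal s \<longleftrightarrow> s dvd x"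
  by (auto simp: principal_ideal_def module.span_singleton[OF ring_module] dvd_def mult.commute)

lemma sq_form_pCons: "sq_form a = [:[:0, 0, 1:], [:0, 2 * a:], [:a\<^sup>2:]:]"
  by (simp add: sq_form_def var_x_def var_y_def const2_def power2_eq_square)

lemma sq_form_nonzero: "sq_form a \<noteq> (0 :: 'k::field poly poly)"
  by (simp add: sq_form_pCons)

lemma var_y_dvd_iff: "var_y dvd p \<longleftrightarrow> coeff p 0 = 0"
  for p :: "'k::field poly poly"
  by (simp add: var_y_def dvd_iff_poly_eq_0[of 0, simplified] poly_0_coeff_0)

text \<open>Modulo \<open>var_x + const2 q * var_y\<close> the other form is a nonzero constant
  multiple of \<open>var_y\<close>, so it is enough to cancel \<open>var_y\<close>. That works
  because the form with \<open>q\<close> restricts to \<open>var_x\<close>, which is not zero, where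
  \<open>var_y\<close> is 0.\<close>

lemma linear_form_dvd_cancel:
  fixes p q :: "'k::field"
  assumes "p \<noteq> q" and "var_x + const2 q * var_y dvd s * (var_x + const2 p * var_y)"
  shows "var_x + const2 q * var_y dvd s"
proof -
  let ?Y = "var_x + const2 q * var_y"
  have "s * (var_x + const2 p * var_y) - s * ?Y = const2 (p - q) * (s * var_y)"
    by (simp add: const2_def diff_pCons[symmetric, where q = 0 and b = 0, simplified] algebra_simps
        flip: smult_diff_left)
  then have "?Y dvd const2 (p - q) * (s * var_y)"
    using assms(2) by (metis dvd_diff dvd_triv_right)
  then have "?Y dvd const2 (inverse (p - q)) * (const2 (p - q) * (s * var_y))"
    by (rule dvd_mult)
  also have "\<dots> = s * var_y"
    using assms(1) by (simp add: const2_def flip: one_pCons)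
  finally obtain h where h: "s * var_y = ?Y * h" ..
  then have "coeff (?Y * h) 0 = 0"
    by (metis dvd_triv_right var_y_dvd_iff)
  then have "coeff h 0 = 0"
    by (simp add: var_x_def var_y_def const2_def mult_pCons_left)
  then obtain h' where "h = h' * var_y"
    unfolding var_y_dvd_iff[symmetric] by (metis dvdE mult.commute)
  with h have "s * var_y = (?Y * h') * var_y"
    by (simp add: mult.assoc)
  then have "s = ?Y * h'"
    by (simp add: var_y_def)
  then show ?thesis by simp
qed

text \<open>The factor \<open>?Y\<close> is extracted twice: first from \<open>s\<close>, then,
  after one \<open>?Y\<close> has been cancelled, from the quotient \<open>t\<close>.\<close>

lemma sq_form_dvd_cancel:
  fixes p q :: "'k::field"
  assumes "p \<noteq> q" and "sq_form q dvd s * sq_form p"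
  shows "sq_form q dvd s"
proof -
  let ?X = "var_x + const2 p * var_y" and ?Y = "var_x + const2 q * var_y"
  have cancel: "?Y dvd t" if "?Y dvd t * ?X * ?X" for t
    using linear_form_dvd_cancel[OF assms(1)] that by blast
  have "?Y dvd s * ?X * ?X"
    using assms(2) dvd_mult_left[of ?Y ?Y "s * ?X * ?X"]
    by (simp only: sq_form_def power2_eq_square ac_simps)
  then obtain t where t: "s = ?Y * t" using cancel by blast
  have "?Y * ?Y dvd ?Y * (t * ?X * ?X)"
    using assms(2) by (simp add: t sq_form_def power2_eq_square mult.assoc)
  moreover have "?Y \<noteq> 0" by (simp add: var_x_def var_y_def const2_def)
  ultimately have "?Y dvd t * ?X * ?X" by (simp only: dvd_mult_cancel_left simp_thms)
  then have "?Y dvd t" by (rule cancel)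
  then show ?thesis by (simp add: t sq_form_def power2_eq_square mult_dvd_mono)
qed

section \<open>Linear relations between squares\<close>

lemma two_nonzero_if_CHAR:
  assumes "CHAR('k::field) \<noteq> 2"
  shows "(2::'k) \<noteq> 0"
proof
  assume "(2::'k) = 0"
  then have "CHAR('k) dvd 2"
    using of_nat_eq_0_iff_char_dvd[where 'a = 'k, of 2] by simp
  then have "CHAR('k) \<le> 2"
    by (rule dvd_imp_le) simp
  moreover have "CHAR('k) \<noteq> 0"
    using \<open>CHAR('k) dvd 2\<close> by (metis dvd_0_left_iff zero_neq_numeral)
  ultimately show False
    using assms CHAR_not_1'[where 'a = 'k] by linarith
qed

text \<open>The part of degree 2 of the identity involves only the constant terms of
  \<open>r\<close>, \<open>s\<close> and \<open>t\<close>, so it is a scalar relation between the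
  three squares. Halving its mixed coefficient leaves a Vandermonde system.\<close>

lemma sq_forms_independent:
  fixes a b c :: "'k::field"
  assumes "CHAR('k) \<noteq> 2" and "distinct [a, b, c]"
    and "r * sq_form a = s * sq_form b + t * sq_form c"
  shows "coeff (coeff r 0) 0 = 0"
proof -
  let ?r = "coeff (coeff r 0) 0" and ?s = "coeff (coeff s 0) 0" and ?t = "coeff (coeff t 0) 0"
  have two: "(2::'k) \<noteq> 0"
    using assms(1) by (rule two_nonzero_if_CHAR)
  have co: "coeff (coeff (r * sq_form a) i) j = coeff (coeff (s * sq_form b + t * sq_form c) i) j" for i j
    by (simp add: assms(3))
  have 1: "?r = ?s + ?t" using co[of 0 2]
    by (simp add: sq_form_pCons coeff_pCons split: nat.splits)
  have 2: "2 * (?r * a) = 2 * (?s * b + ?t * c)" using co[of 1 1]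
    by (simp add: sq_form_pCons coeff_pCons algebra_simps split: nat.splits)
  then have e2: "?r * a = ?s * b + ?t * c" using two by (simp only: mult_left_cancel not_False_eq_True)
  have 3: "?r * a\<^sup>2 = ?s * b\<^sup>2 + ?t * c\<^sup>2" using co[of 2 0]
    by (simp add: sq_form_pCons coeff_pCons algebra_simps split: nat.splits)
  \<comment> \<open>The three equations are combined with the coefficients of
    \<open>(z - b) * (z - c)\<close>, which vanishes at \<open>z = b\<close> and
    \<open>z = c\<close>.\<close>
  have "?r * ((a - b) * (a - c)) = 0"
    using 1 e2 3 by algebra
  then show ?thesis using assms(2) by simp
qed

lemma in_maximal_ideal:
  fixes r :: "'k::field poly poly"
  assumes "coeff (coeff r 0) 0 = 0"
  obtains r1 r2 where "r = r1 * var_x + r2 * var_y"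
proof -
  obtain c r2 where r: "r = pCons c r2" by (cases r)
  obtain d c' where c: "c = pCons d c'" by (cases c)
  have "r = [:c':] * var_x + r2 * var_y"
    using assms by (simp add: r c var_x_def var_y_def)
  then show thesis by (rule that)
qed

text \<open>The scalars are the Lagrange weights of the nodes \<open>p\<close>, \<open>q\<close>,
  \<open>r\<close> at \<open>s\<close>. They reproduce 1, \<open>s\<close> and
  \<open>s\<^sup>2\<close>, which up to a factor 2 are the coefficients of
  \<open>sq_form s\<close>.\<close>

lemma sq_form_interpolation:
  fixes p q r s :: "'k::field"
  assumes "distinct [p, q, r]"
  shows "\<exists>c1 c2 c3. sq_form s = const2 c1 * sq_form p + const2 c2 * sq_form q + const2 c3 * sq_form r"
proof -
  define c1 where "c1 = (s - q) * (s - r) / ((p - q) * (p - r))"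
  define c2 where "c2 = - (s - p) * (s - r) / ((p - q) * (q - r))"
  define c3 where "c3 = (s - p) * (s - q) / ((p - r) * (q - r))"
  have ne: "p \<noteq> q" "p \<noteq> r" "q \<noteq> r" using assms by auto
  have "c1 + c2 + c3 = 1" "c1 * p + c2 * q + c3 * r = s" "c1 * p\<^sup>2 + c2 * q\<^sup>2 + c3 * r\<^sup>2 = s\<^sup>2"
    using ne unfolding c1_def c2_def c3_def
    by (simp_all add: divide_simps) (simp_all add: algebra_simps power2_eq_square)
  then have "sq_form s = const2 c1 * sq_form p + const2 c2 * sq_form q + const2 c3 * sq_form r"
    by (simp add: sq_form_pCons const2_def) algebra
  then show ?thesis by blast
qed

section \<open>Homogeneous polynomials and linear syzygies\<close>

lemma homogeneous_linear_form:
  "homogeneous 1 (const2 a * var_x + const2 b * var_y)"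
  by (auto simp: homogeneous_def const2_def var_x_def var_y_def coeff_pCons split: nat.splits)

lemma homogeneous_1_cases:
  fixes p :: "'k::field poly poly"
  assumes "homogeneous 1 p"
  obtains a b where "p = const2 a * var_x + const2 b * var_y"
proof
  show "p = const2 (coeff (coeff p 0) 1) * var_x + const2 (coeff (coeff p 1) 0) * var_y"
    using assms unfolding homogeneous_def
    by (intro poly_eqI) (force simp: const2_def var_x_def var_y_def coeff_pCons split: nat.splits)
qed

lemma homogeneous_sq_form: "homogeneous 2 (sq_form a)"
  by (auto simp: homogeneous_def sq_form_pCons coeff_pCons split: nat.splits)

lemma homogeneous_diff: "homogeneous d p \<Longrightarrow> homogeneous d q \<Longrightarrow> homogeneous d (p - q)"
  for p q :: "'k::field poly poly"
  unfolding homogeneous_def coeff_diff by (metis diff_self)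

lemma homogeneous_mult:
  fixes p q :: "'k::field poly poly"
  assumes "homogeneous d p" "homogeneous e q"
  shows "homogeneous (d + e) (p * q)"
  unfolding homogeneous_def
proof (intro allI impI)
  fix i j assume "coeff (coeff (p * q) j) i \<noteq> 0"
  then have "(\<Sum>k\<le>j. \<Sum>l\<le>i. coeff (coeff p k) l * coeff (coeff q (j - k)) (i - l)) \<noteq> 0"
    by (simp add: coeff_mult coeff_sum)
  then obtain k where k: "k \<le> j" "(\<Sum>l\<le>i. coeff (coeff p k) l * coeff (coeff q (j - k)) (i - l)) \<noteq> 0"
    by (metis (no_types, lifting) sum.not_neutral_contains_not_neutral atMost_iff)
  then obtain l where l: "l \<le> i" "coeff (coeff p k) l * coeff (coeff q (j - k)) (i - l) \<noteq> 0"
    by (metis (no_types, lifting) sum.not_neutral_contains_not_neutral atMost_iff)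
  then have "l + k = d" "i - l + (j - k) = e"
    using assms unfolding homogeneous_def by (metis mult_zero_left, metis mult_zero_right)
  then show "i + j = d + e" using k l by simp
qed

lemma homogeneous_const2: "homogeneous 0 (const2 c)"
  by (auto simp: homogeneous_def const2_def coeff_pCons split: nat.splits)

lemma homogeneous_vars: "homogeneous 1 (var_x :: 'k::field poly poly)" "homogeneous 1 (var_y :: 'k poly poly)"
  using homogeneous_linear_form[of "1::'k" 0] homogeneous_linear_form[of 0 "1::'k"]
  by (simp_all add: const2_def flip: one_pCons)

text \<open>The linear forms in \<open>good_coeffs\<close> are given only through their equations;
  uniqueness transfers a syzygy computed for one explicit choice to every other. Two solutions
  differ by a linear syzygy between squares without common factor, and such a syzygy would need
  degree 2.\<close>

lemma linear_combination_unique: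
  fixes q s :: "'k::field"
  assumes "CHAR('k) \<noteq> 2" "q \<noteq> s" "homogeneous 1 f" "homogeneous 1 g" "homogeneous 1 f'" "homogeneous 1 g'"
    and "f * sq_form q + g * sq_form s = f' * sq_form q + g' * sq_form s"
  shows "g = g'"
proof -
  obtain a1 b1 a2 b2 a3 b3 a4 b4 where
    eqs: "f = const2 a1 * var_x + const2 b1 * var_y" "g = const2 a2 * var_x + const2 b2 * var_y"
      "f' = const2 a3 * var_x + const2 b3 * var_y" "g' = const2 a4 * var_x + const2 b4 * var_y"
    using assms(3-6) by (metis homogeneous_1_cases)
  define \<phi> \<psi> \<alpha> \<beta> where "\<phi> = a1 - a3" "\<psi> = b1 - b3" "\<alpha> = a2 - a4" "\<beta> = b2 - b4"
  note defs = this
  \<comment> \<open>The coefficients of the four cubic monomials, from \<open>x^3\<close> to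
    \<open>y^3\<close>.\<close>
  have "\<phi> + \<alpha> = 0" "2 * q * \<phi> + \<psi> + 2 * s * \<alpha> + \<beta> = 0"
    "q\<^sup>2 * \<phi> + 2 * q * \<psi> + s\<^sup>2 * \<alpha> + 2 * s * \<beta> = 0" "q\<^sup>2 * \<psi> + s\<^sup>2 * \<beta> = 0"
    using assms(7) unfolding eqs defs
    by (simp_all add: sq_form_pCons const2_def var_x_def var_y_def) algebra+
  \<comment> \<open>Eliminating \<phi> and \<psi> leaves a triangular system with diagonal
    \<open>(q - s)^3\<close>, \<open>2 * (q - s)\<close>.\<close>
  then have "(q - s) * (q - s) * (q - s) * \<alpha> = 0" "2 * (q - s) * \<beta> = (q - s) * (s - 3 * q) * \<alpha>"
    by algebra+
  then have "\<alpha> = 0" "\<beta> = 0"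
    using assms(2) two_nonzero_if_CHAR[OF assms(1)] by auto
  then show ?thesis by (simp add: eqs defs)
qed

text \<open>
  In the coordinates \<open>X = x + q y\<close>, \<open>Y = x + s y\<close> the form of \<open>p\<close> is \<open>(l X + m Y)\<^sup>2\<close>, and each cubic
  monomial in \<open>X\<close>, \<open>Y\<close> is divisible by \<open>X\<^sup>2\<close> or by \<open>Y\<^sup>2\<close>.
\<close>

lemma syzygy_exists:
  fixes p q s :: "'k::field"
  assumes "q \<noteq> s"
  defines "c \<equiv> 2 * ((p - s) * (q - p)) / (q - s) ^ 3"
  obtains f1 g1 f2 g2 where
    "homogeneous 1 f1" "homogeneous 1 g1" "homogeneous 1 f2" "homogeneous 1 g2"
    "var_x * sq_form p = f1 * sq_form q + g1 * sq_form s"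
    "var_y * sq_form p = f2 * sq_form q + g2 * sq_form s"
    "var_y * g1 - var_x * g2 = const2 c * sq_form q"
proof -
  define X where "X = var_x + const2 q * var_y"
  define Y where "Y = var_x + const2 s * var_y"
  define Z where "Z = var_x + const2 p * var_y"
  define d where "d = q - s"
  define l m where "l = (p - s) / d" "m = (q - p) / d"
  define x1 x2 y1 y2 where "x1 = - s / d" "x2 = q / d" "y1 = 1 / d" "y2 = - (1 / d)"
  note defs = this \<open>l = _\<close> \<open>m = _\<close>
  have d: "d \<noteq> 0" using assms(1) by (simp add: d_def)
  have "x1 + x2 = 1" "x1 * q + x2 * s = 0" "y1 + y2 = 0" "y1 * q + y2 * s = 1"
    "l + m = 1" "l * q + m * s = p"
    using d unfolding defs by (simp_all add: field_simps) (simp_all add: d_def algebra_simps)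
  then have x: "var_x = const2 x1 * X + const2 x2 * Y" and y: "var_y = const2 y1 * X + const2 y2 * Y"
    and z: "Z = const2 l * X + const2 m * Y"
    by (simp_all add: X_def Y_def Z_def var_x_def var_y_def const2_def algebra_simps)
  \<comment> \<open>The last factor is a determinant of the coordinate change and equals
    \<open>1 / d\<close>.\<close>
  have c: "c = 2 * (l * m) * (y1 * x2 - x1 * y2)"
    using d unfolding defs c_def d_def[symmetric] by (simp add: field_simps power3_eq_cube) (simp add: d_def algebra_simps)
  define F where "F z1 z2 = const2 (z1 * l\<^sup>2) * X + const2 (2 * (l * m) * z1 + z2 * l\<^sup>2) * Y" for z1 z2
  define G where "G z1 z2 = const2 (z1 * m\<^sup>2 + 2 * (l * m) * z2) * X + const2 (z2 * m\<^sup>2) * Y" for z1 z2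
  have const2: "const2 (a * b) = const2 a * const2 b" "const2 (a + b) = const2 a + const2 b"
    "const2 (a - b) = const2 a - const2 b" "const2 2 = 2" for a b :: 'k
    by (simp_all add: const2_def flip: numeral_poly)
  have FG: "(const2 z1 * X + const2 z2 * Y) * Z\<^sup>2 = F z1 z2 * X\<^sup>2 + G z1 z2 * Y\<^sup>2" for z1 z2
    unfolding F_def G_def z by (simp add: const2 power2_eq_square algebra_simps)
  have hom: "homogeneous 1 (const2 a * X + const2 b * Y)" for a b
  proof -
    have "const2 a * X + const2 b * Y = const2 (a + b) * var_x + const2 (a * q + b * s) * var_y"
      by (simp add: X_def Y_def const2 algebra_simps)
    then show ?thesis by (simp only: homogeneous_linear_form)
  qed
  show thesis
  proof (rule that)
    show "homogeneous 1 (F x1 x2)" "homogeneous 1 (G x1 x2)" "homogeneous 1 (F y1 y2)" "homogeneous 1 (G y1 y2)"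
      unfolding F_def G_def by (rule hom)+
    show "var_x * sq_form p = F x1 x2 * sq_form q + G x1 x2 * sq_form s"
      "var_y * sq_form p = F y1 y2 * sq_form q + G y1 y2 * sq_form s"
      using FG[of x1 x2] FG[of y1 y2] unfolding x[symmetric] y[symmetric] by (simp_all add: sq_form_def X_def Y_def Z_def)
    \<comment> \<open>The terms with \<open>m\<^sup>2\<close> and those in \<open>X * Y\<close> and
      \<open>Y\<^sup>2\<close> cancel; only the mixed coefficient \<open>2 * (l * m)\<close> of the
      square survives.\<close>
    have "(const2 y1 * X + const2 y2 * Y) * G x1 x2 - (const2 x1 * X + const2 x2 * Y) * G y1 y2 = const2 c * X\<^sup>2"
      unfolding G_def c by (simp add: const2 power2_eq_square algebra_simps)
    then show "var_y * G x1 x2 - var_x * G y1 y2 = const2 c * sq_form q"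
      unfolding x[symmetric] y[symmetric] by (simp add: sq_form_def X_def)
  qed
qed

text \<open>By uniqueness \<open>g1\<close> and \<open>g2\<close> are the explicit forms of
  \<open>syzygy_exists\<close>, and their constant vanishes only if 2 is 0 or \<open>p\<close>
  equals \<open>q\<close> or \<open>s\<close>.\<close>

lemma syzygy:
  fixes p q s :: "'k::field"
  assumes "CHAR('k) \<noteq> 2" "distinct [p, q, s]"
    and hom: "homogeneous 1 f1" "homogeneous 1 g1" "homogeneous 1 f2" "homogeneous 1 g2"
    and eqs: "var_x * sq_form p = f1 * sq_form q + g1 * sq_form s"
      "var_y * sq_form p = f2 * sq_form q + g2 * sq_form s"
  obtains c where "c \<noteq> 0" "var_y * g1 - var_x * g2 = const2 c * sq_form q"
proof -
  have qs: "q \<noteq> s" using assms(2) by simp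
  obtain f1' g1' f2' g2' where hom': "homogeneous 1 f1'" "homogeneous 1 g1'" "homogeneous 1 f2'" "homogeneous 1 g2'"
    and eqs': "var_x * sq_form p = f1' * sq_form q + g1' * sq_form s"
      "var_y * sq_form p = f2' * sq_form q + g2' * sq_form s"
    and syz: "var_y * g1' - var_x * g2' = const2 (2 * ((p - s) * (q - p)) / (q - s) ^ 3) * sq_form q"
    by (rule syzygy_exists[OF qs])
  have "g1 = g1'" "g2 = g2'"
    using linear_combination_unique[OF assms(1) qs hom(1,2) hom'(1,2)] linear_combination_unique[OF assms(1) qs hom(3,4) hom'(3,4)]
    by (simp_all only: flip: eqs eqs')
  moreover have "2 * ((p - s) * (q - p)) / (q - s) ^ 3 \<noteq> 0"
    using assms(2) two_nonzero_if_CHAR[OF assms(1)] by auto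
  ultimately show thesis using that syz by blast
qed

section \<open>Size of generating sets\<close>

lemma vector_space_functions:
  "vector_space (scale_coordwise :: 'r::field \<Rightarrow> ('v \<Rightarrow> 'r) \<Rightarrow> _)"
  by unfold_locales (simp_all add: scale_coordwise_def fun_eq_iff distrib_left distrib_right)

text \<open>Extension of scalars: over the fraction field, dimension arguments become
  available.\<close>

lemma to_fract_span:
  fixes b :: "'v \<Rightarrow> 'r::idom"
  assumes "b \<in> coordwise.span B"
  shows "to_fract \<circ> b \<in> coordwise.span ((\<circ>) to_fract ` B)"
  using assms
proof (induction rule: coordwise.span_induct_alt)
  case base
  have "to_fract \<circ> 0 = (0 :: 'v \<Rightarrow> 'r fract)" by (simp add: fun_eq_iff)
  then show ?case by (simp only: coordwise.span_zero)
next
  case (step c x y)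
  have "to_fract \<circ> (scale_coordwise c x + y) = scale_coordwise (to_fract c) (to_fract \<circ> x) + (to_fract \<circ> y)"
    by (simp add: fun_eq_iff scale_coordwise_def)
  moreover have "to_fract \<circ> x \<in> (\<circ>) to_fract ` B"
    using step(1) by blast
  ultimately show ?case
    using step(2) by (simp only: coordwise.span_add coordwise.span_scale coordwise.span_base)
qed

definition unit_vector :: "'v \<Rightarrow> 'r::comm_ring_1 \<Rightarrow> 'v \<Rightarrow> 'r" where
  "unit_vector v r = (\<lambda>z. if z = v then r else 0)"

lemma independent_unit_vectors:
  fixes V :: "'v set"
  assumes "finite V"
  shows "\<not> coordwise.dependent ((\<lambda>v. unit_vector v (1::'r::field)) ` V)"
proof -
  interpret V: vector_space "scale_coordwise :: 'r \<Rightarrow> ('v \<Rightarrow> 'r) \<Rightarrow> _"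
    by (rule vector_space_functions)
  have inj: "inj_on (\<lambda>v. unit_vector v (1::'r)) V"
    by (rule inj_onI) (metis unit_vector_def zero_neq_one)
  show ?thesis
  proof (rule V.independent_if_scalars_zero)
    show "finite ((\<lambda>v. unit_vector v (1::'r)) ` V)" using assms by simp
  next
    fix f :: "('v \<Rightarrow> 'r) \<Rightarrow> 'r" and x :: "'v \<Rightarrow> 'r"
    assume sum: "(\<Sum>x\<in>(\<lambda>v. unit_vector v 1) ` V. scale_coordwise (f x) x) = 0"
      and "x \<in> (\<lambda>v. unit_vector v 1) ` V"
    then obtain v where v: "v \<in> V" "x = unit_vector v 1" by blast
    have "0 = (\<Sum>w\<in>V. scale_coordwise (f (unit_vector w 1)) (unit_vector w 1)) v"
      using sum by (simp add: sum.reindex[OF inj])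
    also have "\<dots> = (\<Sum>w\<in>V. scale_coordwise (f (unit_vector w 1)) (unit_vector w 1) v)"
      using assms by (induction V rule: finite_induct) simp_all
    also have "\<dots> = (\<Sum>w\<in>V. if w = v then f x else 0)"
      by (rule sum.cong) (auto simp: scale_coordwise_def unit_vector_def v(2))
    also have "\<dots> = f x" using assms v(1) by simp
    finally show "f x = 0" by simp
  qed
qed

lemma card_generating_set_ge:
  fixes G :: "('v, 'r::idom) labeled_graph"
  assumes "generates_splines G B" "finite B" "finite (verts G)" "d \<noteq> 0"
    and "\<And>v. v \<in> verts G \<Longrightarrow> unit_vector v d \<in> splines G"
  shows "card (verts G) \<le> card B"
proof -
  interpret V: vector_space "scale_coordwise :: 'r fract \<Rightarrow> ('v \<Rightarrow> 'r fract) \<Rightarrow> _"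
    by (rule vector_space_functions)
  let ?E = "(\<lambda>v. unit_vector v (1::'r fract)) ` verts G" and ?T = "(\<circ>) to_fract ` B"
  have "?E \<subseteq> coordwise.span ?T"
  proof safe
    fix v assume "v \<in> verts G"
    then have "unit_vector v d \<in> coordwise.span B"
      using assms(1,5) by (simp add: generates_splines_def)
    \<comment> \<open>The factor \<open>d\<close> is invertible in the fraction field, so the unit
      vectors themselves lie in the span.\<close>
    then have "scale_coordwise (inverse (to_fract d)) (to_fract \<circ> unit_vector v d) \<in> coordwise.span ?T"
      by (intro coordwise.span_scale to_fract_span)
    also have "scale_coordwise (inverse (to_fract d)) (to_fract \<circ> unit_vector v d) = unit_vector v 1"
      using assms(4) by (auto simp: scale_coordwise_def unit_vector_def)
    finally show "unit_vector v 1 \<in> coordwise.span ?T" .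
  qed
  then have "card ?E \<le> card ?T"
    using V.independent_span_bound[of ?T ?E] independent_unit_vectors assms(2,3) by blast
  moreover have "inj_on (\<lambda>v. unit_vector v (1::'r fract)) (verts G)"
    by (rule inj_onI) (metis unit_vector_def zero_neq_one)
  ultimately show ?thesis
    using card_image_le[OF assms(2), of "(\<circ>) to_fract"] by (simp add: card_image)
qed

lemma min_generating_setI:
  fixes G :: "('v, 'r::idom) labeled_graph"
  assumes "generates_splines G B" "finite B" "card B \<le> card (verts G)" "finite (verts G)" "d \<noteq> 0"
    and "\<And>v. v \<in> verts G \<Longrightarrow> unit_vector v d \<in> splines G"
  shows "min_generating_set G B"
  unfolding min_generating_set_def
proof (intro conjI allI impI assms(1) notI)
  fix B' assume B': "generates_splines G B'" "B' \<prec> B"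
  \<comment> \<open>A set strictly below the finite \<open>B\<close> is finite, so the comparison
    becomes one of natural numbers.\<close>
  then have "finite B'" by (meson assms(2) infinite_le_lepoll lepoll_trans lesspoll_imp_lepoll)
  then have "card B' < card B" 
    using B'(2) assms(2) by (metis eqpoll_iff_card lepoll_iff_card_le lesspoll_def order_less_le)
  moreover have "card (verts G) \<le> card B'"
    by (rule card_generating_set_ge) fact+
  ultimately show False using assms(3) by simp
qed

text \<open>The product of all label generators lies in every label, so it serves as one common
  multiplier for all vertices.\<close>

lemma unit_vector_product_spline:
  fixes G :: "('v, 'r::idom) labeled_graph"
  assumes "finite (edges G)" "v \<in> verts G"
    and "\<And>e. e \<in> edges G \<Longrightarrow> label G e = principal_ideal (s e)"
  shows "unit_vector v (\<Prod>e\<in>edges G. s e) \<in> splines G"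
proof -
  have "s e dvd (\<Prod>e\<in>edges G. s e)" if "e \<in> edges G" for e
    using assms(1) that by (rule dvd_prodI)
  then show ?thesis
    using assms(2,3) by (auto simp: splines_def unit_vector_def mem_principal_ideal)
qed

lemma splines_diff_edge:
  assumes "p \<in> splines G" "{u, v} \<in> edges G"
  shows "p u - p v \<in> label G {u, v}"
  using assms by (simp add: splines_def)

lemma principal_ideal_subspace: "module.subspace (*) (principal_ideal s)"
  unfolding principal_ideal_def by (rule module.subspace_span[OF ring_module])

lemma subspace_splines_principal:
  assumes "\<And>e. e \<in> edges G \<Longrightarrow> \<exists>s. label G e = principal_ideal s"
  shows "coordwise.subspace (splines G)"
  using assms by (intro subspace_splines) (metis principal_ideal_subspace)

text \<open>The homogeneity half of \<open>homogeneous_mgs\<close>, separated from minimality so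
  that it can be carried through the reinsertions.\<close>

definition homogeneous_vectors :: "'v set \<Rightarrow> ('v \<Rightarrow> 'k::comm_ring_1 poly poly) set \<Rightarrow> bool" where
  "homogeneous_vectors V B \<longleftrightarrow> (\<forall>b\<in>B. \<exists>d. \<forall>v\<in>V. b v \<noteq> 0 \<longrightarrow> homogeneous d (b v))"

section \<open>Cycles and elimination of vertices\<close>

lemma is_cycle_finite:
  assumes "is_cycle n G"
  shows "finite (verts G)" "card (verts G) = n" "finite (edges G)"
proof -
  obtain v where v: "bij_betw v {1..n} (verts G)" "edges G = (\<lambda>i. {v (i - 1), v i}) ` {1..n}"
    using assms by (auto simp: is_cycle_def cyclic_order_def)
  show "finite (verts G)" using bij_betw_finite[OF v(1)] by simp
  show "card (verts G) = n" using bij_betw_same_card[OF v(1)] by simp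
  show "finite (edges G)" using v(2) by simp
qed

text \<open>With indices starting at 0, rotating an enumeration is addition modulo
  \<open>n\<close>.\<close>

lemma cyclic_order_lessThan:
  assumes "n \<ge> 1"
  shows "cyclic_order n G v \<longleftrightarrow> v 0 = v n \<and> bij_betw v {..<n} (verts G) \<and>
     edges G = (\<lambda>i. {v i, v (Suc i)}) ` {..<n}"
proof -
  have sets: "{1..n} = insert n {1..<n}" "{..<n} = insert 0 {1..<n}" using assms by auto
  have "bij_betw v {1..n} (verts G) \<longleftrightarrow> bij_betw v {..<n} (verts G)" if "v 0 = v n"
    unfolding sets using that by (simp add: bij_betw_def inj_on_insert)
  moreover have "{1..n} = Suc ` {..<n}" by (simp add: lessThan_atLeast0 image_Suc_atLeastLessThan atLeastLessThanSuc_atLeastAtMost)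
  ultimately show ?thesis by (auto simp: cyclic_order_def image_image)
qed

lemma cyclic_order_rotate:
  assumes "cyclic_order n G v" "n \<ge> 1"
  shows "cyclic_order n G (\<lambda>i. v ((i + s) mod n))"
proof -
  have v: "v 0 = v n" "bij_betw v {..<n} (verts G)" "edges G = (\<lambda>i. {v i, v (Suc i)}) ` {..<n}"
    using assms cyclic_order_lessThan by blast+
  have "inj_on (\<lambda>i. (i + s) mod n) {..<n}"
  proof (rule inj_onI)
    fix i j assume ij: "i \<in> {..<n}" "j \<in> {..<n}" "(i + s) mod n = (j + s) mod n"
    then obtain q r where "i + s + n * q = j + s + n * r" unfolding nat_mod_eq_iff by blast
    then have "i + n * q = j + n * r" by simp
    then have "i mod n = j mod n" unfolding nat_mod_eq_iff by blast
    then show "i = j" using ij by simp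
  qed
  then have b: "bij_betw (\<lambda>i. (i + s) mod n) {..<n} {..<n}"
    using assms(2) by (intro bij_betw_imageI endo_inj_surj) auto
  \<comment> \<open>The closing condition \<open>v 0 = v n\<close> absorbs the wrap-around at
    \<open>i = n - 1\<close>.\<close>
  have "v (Suc i mod n) = v (Suc i)" if "i < n" for i
    using that v(1) by (metis Suc_lessI mod_less mod_self)
  then have "{v ((i + s) mod n), v ((Suc i + s) mod n)} = (\<lambda>i. {v i, v (Suc i)}) ((i + s) mod n)" for i
    using assms(2) by (metis (no_types, lifting) add_Suc mod_Suc_eq mod_less_divisor zero_less_one less_le_trans)
  then have "(\<lambda>i. {v ((i + s) mod n), v ((Suc i + s) mod n)}) ` {..<n} = (\<lambda>i. {v i, v (Suc i)}) ` (\<lambda>i. (i + s) mod n) ` {..<n}"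
    by (simp add: image_image)
  then show ?thesis
    using assms(2) v b bij_betw_trans[OF b v(2)] by (simp add: cyclic_order_lessThan bij_betw_def o_def)
qed

lemma homogeneous_mgsI:
  fixes G :: "('v, 'k::field poly poly) labeled_graph"
  assumes "is_cycle n G" "\<And>e. e \<in> edges G \<Longrightarrow> \<exists>a. label G e = principal_ideal (sq_form a)"
    and "generates_splines G B" "finite B" "card B \<le> n"
    and "homogeneous_vectors (verts G) B"
  shows "homogeneous_mgs G B"
proof -
  obtain a where a: "\<And>e. e \<in> edges G \<Longrightarrow> label G e = principal_ideal (sq_form (a e))"
    using assms(2) by metis
  note fin = is_cycle_finite[OF assms(1)]
  have "min_generating_set G B"
  proof (rule min_generating_setI)
    show "(\<Prod>e\<in>edges G. sq_form (a e)) \<noteq> 0" using fin(3) by (simp add: sq_form_nonzero)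
    show "unit_vector v (\<Prod>e\<in>edges G. sq_form (a e)) \<in> splines G" if "v \<in> verts G" for v
      using fin(3) that a by (rule unit_vector_product_spline)
  qed (use assms fin in auto)
  then show ?thesis using assms(6) by (simp add: homogeneous_mgs_def homogeneous_vectors_def)
qed

lemma cyclic_orderD:
  assumes "cyclic_order n G v" "n \<ge> 1"
  shows "v n = v 0" "inj_on v {..<n}" "verts G = v ` {..<n}" "edges G = (\<lambda>i. {v i, v (Suc i)}) ` {..<n}"
  using assms by (auto simp: cyclic_order_lessThan bij_betw_def)

section \<open>Elimination of vertices down to a reduced cycle\<close>

lemma cyclic_order_start:
  assumes "is_cycle n G" "x \<in> verts G"
  obtains v where "cyclic_order n G v" "v 0 = x"
proof -
  obtain v where v: "cyclic_order n G v" and n: "n \<ge> 3" using assms(1) by (auto simp: is_cycle_def)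
  then obtain j where "j < n" "x = v j"
    using assms(2) cyclic_orderD(3)[OF v] by auto
  then show thesis
    using cyclic_order_rotate[OF v, of j] n by (intro that[of "\<lambda>i. v ((i + j) mod n)"]) simp_all
qed

lemma edges_at_start:
  assumes "cyclic_order n G v" "n \<ge> 3" "e \<in> edges G"
  shows "v 0 \<in> e \<longleftrightarrow> e = {v 0, v 1} \<or> e = {v (n - 1), v 0}"
proof
  have n: "n \<ge> 1" using assms(2) by simp
  note v = cyclic_orderD[OF assms(1) n]
  assume "v 0 \<in> e"
  obtain i where i: "i < n" "e = {v i, v (Suc i)}" using v(4) assms(3) by auto
  show "e = {v 0, v 1} \<or> e = {v (n - 1), v 0}"
  proof (cases "Suc i = n")
    case True
    then show ?thesis using i v(1) by auto
  next
    case False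
    then have "v 0 \<noteq> v (Suc i)" using i(1) inj_onD[OF v(2), of 0 "Suc i"] by auto
    then have "v 0 = v i" using i(2) \<open>v 0 \<in> e\<close> by auto
    then have "i = 0" using i(1) inj_onD[OF v(2), of 0 i] by auto
    then show ?thesis using i(2) by simp
  qed
qed auto

text \<open>Enumerated from \<open>x = v 0\<close>, the neighbors are \<open>v 1\<close> and
  \<open>v (n - 1)\<close>; the new edge closes the path between them that avoids \<open>x\<close>.
  Since there are three labels, the cycle is no triangle and the new edge was absent before.\<close>

lemma eliminates_cycle:
  assumes cyc: "is_cycle n G" and lab: "3 \<le> card (label G ` edges G)" and elim: "eliminates G x u w I G'"
  shows "4 \<le> n" "x \<in> verts G" "u \<in> verts G" "w \<in> verts G" "u \<noteq> x" "w \<noteq> x" "{u, w} \<notin> edges G"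
    and "\<And>e. e \<in> edges G \<Longrightarrow> x \<in> e \<Longrightarrow> e = {u, x} \<or> e = {x, w}"
    and "is_cycle (n - 1) G'"
proof -
  have n: "n \<ge> 3" "n \<ge> 1" using cyc by (auto simp: is_cycle_def)
  have uw: "u \<noteq> w" "{u, x} \<in> edges G" "{x, w} \<in> edges G" "label G {u, x} = I" "label G {x, w} = I"
    and G': "G' = \<lparr>verts = verts G - {x}, edges = insert {u, w} (edges G - {{u, x}, {x, w}}),
        label = (label G)({u, w} := I)\<rparr>"
    using elim by (auto simp: eliminates_def)
  obtain v' where v': "cyclic_order n G v'" using cyc by (auto simp: is_cycle_def)
  obtain i where "i < n" "x = v' i \<or> x = v' (Suc i)"
    using uw(2) cyclic_orderD(4)[OF v' n(2)] by (auto simp: doubleton_eq_iff)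
  then show x: "x \<in> verts G"
    using cyclic_orderD(1,3)[OF v' n(2)] n(2) by (cases "Suc i = n") auto
  obtain v where vo: "cyclic_order n G v" and v0: "v 0 = x"
    using cyclic_order_start[OF cyc x] .
  note v = cyclic_orderD[OF vo n(2)]
  have vinj: "v i = v j \<longleftrightarrow> i = j" if "i < n" "j < n" for i j
    using v(2) that by (auto simp: inj_on_def)
  have vx: "v i = x \<longleftrightarrow> i = 0" if "i < n" for i
    using vinj[of i 0] that v0 by auto
  have ne: "v 1 \<noteq> x" "v (n - 1) \<noteq> x" using vx n by simp_all
  have inc: "e = {x, v 1} \<or> e = {v (n - 1), x}" if "e \<in> edges G" "x \<in> e" for e
    using edges_at_start[OF vo n(1)] that v0 by auto
  have "u = v 1 \<or> u = v (n - 1)" "w = v 1 \<or> w = v (n - 1)"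
    using inc[OF uw(2)] inc[OF uw(3)] ne by (auto simp: doubleton_eq_iff)
  with uw(1) have uwv: "u = v 1 \<and> w = v (n - 1) \<or> u = v (n - 1) \<and> w = v 1" by auto
  then show "u \<noteq> x" "w \<noteq> x" "u \<in> verts G" "w \<in> verts G" using ne n v(3) by auto
  show inc': "e = {u, x} \<or> e = {x, w}" if "e \<in> edges G" "x \<in> e" for e
    using inc[OF that] uwv by auto
  \<comment> \<open>On a triangle both edges at \<open>x\<close> carry \<open>I\<close> and one edge
    is left, which allows at most two labels.\<close>
  show n4: "4 \<le> n"
  proof (rule ccontr)
    assume "\<not> 4 \<le> n"
    then have n3: "n = 3" using n by simp
    have "label G e \<in> {I, label G {v 1, v 2}}" if "e \<in> edges G" for e
    proof (cases "x \<in> e")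
      case True
      then show ?thesis using inc'[OF that] uw by auto
    next
      case False
      obtain i where i: "i < 3" "e = {v i, v (Suc i)}" using v(4) n3 \<open>e \<in> edges G\<close> by auto
      then have "i = 1" using v(1) False v0 n3 by (auto simp: less_Suc_eq numeral_3_eq_3)
      then show ?thesis using i(2) by (simp add: numeral_2_eq_2)
    qed
    then have "label G ` edges G \<subseteq> {I, label G {v 1, v 2}}" by blast
    then have "card (label G ` edges G) \<le> card {I, label G {v 1, v 2}}" by (rule card_mono[rotated]) simp
    also have "\<dots> \<le> 2" by (simp add: card_insert_le_m1)
    finally show False using lab by simp
  qed
  show "{u, w} \<notin> edges G"
  proof
    assume "{u, w} \<in> edges G"
    then obtain i where i: "i < n" "{v 1, v (n - 1)} = {v i, v (Suc i)}"
      using v(4) uwv by (auto simp: insert_commute)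
    show False
    proof (cases "Suc i = n")
      case True
      then show False using i v(1) v0 ne by (auto simp: doubleton_eq_iff)
    next
      case False
      then show False using i vinj n4 by (auto simp: doubleton_eq_iff)
    qed
  qed
  have edges: "edges G - {{u, x}, {x, w}} = {e \<in> edges G. x \<notin> e}"
    using inc' by auto
  have edges': "{e \<in> edges G. x \<notin> e} = (\<lambda>i. {v (Suc i), v (Suc (Suc i))}) ` {..<n - 2}"
  proof (intro equalityI subsetI)
    fix e assume "e \<in> {e \<in> edges G. x \<notin> e}"
    then have "e \<in> edges G" "x \<notin> e" by simp_all
    then obtain i where i: "i < n" "e = {v i, v (Suc i)}" using v(4) by auto
    moreover have "i \<noteq> 0" "Suc i \<noteq> n" using \<open>x \<notin> e\<close> i(2) v0 v(1) by auto
    ultimately show "e \<in> (\<lambda>i. {v (Suc i), v (Suc (Suc i))}) ` {..<n - 2}"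
      by (intro image_eqI[of _ _ "i - 1"]) auto
  next
    fix e assume "e \<in> (\<lambda>i. {v (Suc i), v (Suc (Suc i))}) ` {..<n - 2}"
    then obtain i where i: "i < n - 2" "e = {v (Suc i), v (Suc (Suc i))}" by auto
    then have "Suc i < n" "Suc (Suc i) < n" by simp_all
    then show "e \<in> {e \<in> edges G. x \<notin> e}"
      using vx[of "Suc i"] vx[of "Suc (Suc i)"] i(2) v(4) by auto
  qed
  \<comment> \<open>The remaining vertices, shifted down by one; index \<open>n - 1\<close> returns
    to \<open>v 1\<close>.\<close>
  let ?w = "\<lambda>i. if i < n - 1 then v (Suc i) else v 1"
  have "cyclic_order (n - 1) G' ?w"
  proof (subst cyclic_order_lessThan; (intro conjI)?)
    have "bij_betw ?w {..<n - 1} (verts G - {x}) \<longleftrightarrow> bij_betw (v \<circ> Suc) {..<n - 1} (verts G - {x})"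
      by (rule bij_betw_cong) simp
    moreover have "bij_betw (v \<circ> Suc) {..<n - 1} (verts G - {x})"
    proof (rule bij_betw_imageI)
      show "inj_on (v \<circ> Suc) {..<n - 1}" by (rule inj_onI) (auto simp: vinj)
      have "{..<n} = insert 0 (Suc ` {..<n - 1})" using lessThan_Suc_eq_insert_0[of "n - 1"] n by simp
      then show "(v \<circ> Suc) ` {..<n - 1} = verts G - {x}"
        using vx unfolding v(3) by (auto simp: v0)
    qed
    ultimately show "bij_betw ?w {..<n - 1} (verts G')" by (simp add: G')
    have "n - 1 = Suc (n - 2)" using n by simp
    then have "(\<lambda>i. {?w i, ?w (Suc i)}) ` {..<n - 1} =
        insert {?w (n - 2), ?w (n - 1)} ((\<lambda>i. {?w i, ?w (Suc i)}) ` {..<n - 2})"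
      by (simp add: lessThan_Suc)
    also have "{?w (n - 2), ?w (n - 1)} = {u, w}"
      using n uwv by (auto simp: Suc_diff_Suc numeral_2_eq_2)
    also have "(\<lambda>i. {?w i, ?w (Suc i)}) ` {..<n - 2} = edges G - {{u, x}, {x, w}}"
      unfolding edges edges' by (rule image_cong) auto
    finally show "edges G' = (\<lambda>i. {?w i, ?w (Suc i)}) ` {..<n - 1}" by (simp add: G')
  qed (use n in auto)
  then show "is_cycle (n - 1) G'" using n4 by (auto simp: is_cycle_def)
qed

text \<open>
  The hypotheses of the theorem in the form in which eliminations preserve them.
\<close>

definition sq_cycle :: "nat \<Rightarrow> ('v, 'k::field poly poly) labeled_graph \<Rightarrow> bool" where
  "sq_cycle n G \<longleftrightarrow> is_cycle n G \<and> (\<forall>e\<in>edges G. \<exists>a. label G e = principal_ideal (sq_form a)) \<and>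
     3 \<le> card (label G ` edges G)"

text \<open>The set of labels survives: the deleted edges carry \<open>I\<close>, the new edge
  carries it again, and since \<open>{u, w}\<close> was no edge, the update of \<open>label\<close>
  overwrites no other label.\<close>

lemma sq_cycle_eliminates:
  assumes "sq_cycle n G" "eliminates G x u w I G'"
  shows "sq_cycle (n - 1) G'" "4 \<le> n" "\<exists>a. I = principal_ideal (sq_form a)"
proof -
  have cyc: "is_cycle n G" "3 \<le> card (label G ` edges G)" using assms(1) by (auto simp: sq_cycle_def)
  note e = eliminates_cycle[OF cyc assms(2)]
  show "4 \<le> n" by (rule e(1))
  have uw: "{u, x} \<in> edges G" "{x, w} \<in> edges G" "label G {u, x} = I" "label G {x, w} = I"
    and G': "edges G' = insert {u, w} (edges G - {{u, x}, {x, w}})" "label G' = (label G)({u, w} := I)"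
    using assms(2) by (auto simp: eliminates_def)
  show I: "\<exists>a. I = principal_ideal (sq_form a)" using uw assms(1) by (auto simp: sq_cycle_def)
  have "label G' ` edges G' = insert I (label G ` (edges G - {{u, x}, {x, w}}))"
    using e(7) by (auto simp: G' fun_upd_def image_def)
  also have "\<dots> = label G ` edges G" using uw by auto
  finally have "label G' ` edges G' = label G ` edges G" .
  moreover have "\<exists>a. label G' e = principal_ideal (sq_form a)" if "e \<in> edges G'" for e
    using that assms(1) I by (auto simp: G' sq_cycle_def)
  ultimately show "sq_cycle (n - 1) G'" using e(9) cyc(2) by (simp add: sq_cycle_def)
qed

lemma sq_cycle_eliminations:
  assumes "eliminations G es G'" "sq_cycle n G"
  shows "sq_cycle (n - length es) G' \<and> length es \<le> n"
  using assms
proof (induction arbitrary: n rule: eliminations.induct)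
  case (2 G v u w I G' es G'')
  note step = sq_cycle_eliminates[OF "2.prems" "2.hyps"(1)]
  show ?case using "2.IH"[OF step(1)] step(2) by auto
qed simp

lemma not_reduced_eliminates:
  assumes "is_cycle n G" "\<not> reduced G"
  shows "\<exists>x u w I G'. eliminates G x u w I G'"
proof -
  obtain e e' where e: "e \<in> edges G" "e' \<in> edges G" "e \<noteq> e'" "e \<inter> e' \<noteq> {}" "label G e = label G e'"
    using assms(2) by (auto simp: reduced_def)
  have doubleton: "\<exists>u. d = {u, x}" if "d \<in> edges G" "x \<in> d" for d x
    using assms(1) that by (auto simp: is_cycle_def cyclic_order_def)
  obtain x where "x \<in> e" "x \<in> e'" using e(4) by blast
  then obtain u w where uw: "e = {u, x}" "e' = {x, w}"
    using doubleton e(1,2) by (metis insert_commute)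
  then have "eliminates G x u w (label G e)
     \<lparr>verts = verts G - {x}, edges = insert {u, w} (edges G - {{u, x}, {x, w}}),
        label = (label G)({u, w} := label G e)\<rparr>"
    using e by (auto simp: eliminates_def)
  then show ?thesis by blast
qed

text \<open>Each elimination shortens the cycle, so the process terminates.\<close>

lemma eliminations_to_reduced:
  assumes "sq_cycle n G"
  shows "\<exists>es Gm. eliminations G es Gm \<and> reduced Gm"
  using assms
proof (induction n arbitrary: G rule: less_induct)
  case (less n)
  show ?case
  proof (cases "reduced G")
    case True
    then show ?thesis by (blast intro: eliminations.intros)
  next
    case False
    then obtain x u w I G' where el: "eliminates G x u w I G'"
      using not_reduced_eliminates less.prems by (metis sq_cycle_def)
    note step = sq_cycle_eliminates[OF less.prems el]
    have "n - 1 < n" using step(2) by simp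
    then show ?thesis using less.IH[OF _ step(1)] el by (blast intro: eliminations.intros)
  qed
qed

text \<open>In a reduced cycle consecutive labels differ. If labels two steps apart always agreed,
  the labels would have period 2 and only two values; so some three consecutive labels are distinct,
  and a rotation brings them into position.\<close>

lemma good_order_exists:
  assumes "sq_cycle m G" "reduced G"
  shows "\<exists>v a. good_order m G v a"
proof -
  have m: "m \<ge> 3" "m \<ge> 1" and lab: "3 \<le> card (label G ` edges G)"
    using assms(1) by (auto simp: sq_cycle_def is_cycle_def)
  obtain v where vo: "cyclic_order m G v" using assms(1) by (auto simp: sq_cycle_def is_cycle_def)
  note v = cyclic_orderD[OF vo m(2)]
  define E where "E i = {v (i mod m), v (Suc i mod m)}" for i
  have E: "E i = {v i, v (Suc i)}" if "i < m" for i
    using that v(1) by (cases "Suc i = m") (auto simp: E_def)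
  have edges: "edges G = E ` {..<m}" unfolding v(4) using E by auto
  have E_mod: "E (i mod m) = E i" for i by (simp add: E_def mod_Suc_eq)
  have E_in: "E i \<in> edges G" for i
    using E_mod[of i] m unfolding edges by (metis imageI lessThan_iff mod_less_divisor zero_less_one less_le_trans)
  have step: "label G (E i) \<noteq> label G (E (Suc i))" for i
  proof -
    have vinj: "v i = v j \<longleftrightarrow> i = j" if "i < m" "j < m" for i j
      using v(2) that by (auto simp: inj_on_def)
    have "i mod m \<noteq> Suc i mod m" "i mod m \<noteq> Suc (Suc i) mod m"
      using m by (auto simp: mod_Suc)
    then have "v (i mod m) \<notin> E (Suc i)" using m by (simp add: E_def vinj)
    then have "E i \<noteq> E (Suc i)" by (auto simp: E_def)
    moreover have "E i \<inter> E (Suc i) \<noteq> {}" by (auto simp: E_def)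
    ultimately show ?thesis using assms(2) E_in by (auto simp: reduced_def)
  qed
  have "\<exists>i. label G (E i) \<noteq> label G (E (Suc (Suc i)))"
  proof (rule ccontr)
    assume "\<not> ?thesis"
    then have per: "label G (E (Suc (Suc i))) = label G (E i)" for i by simp
    have "label G (E i) \<in> {label G (E 0), label G (E 1)}" for i
      by (induction i rule: induct_nat_012) (simp_all add: per)
    then have "label G ` edges G \<subseteq> {label G (E 0), label G (E 1)}" by (auto simp: edges)
    then have "card (label G ` edges G) \<le> card {label G (E 0), label G (E 1)}" by (rule card_mono[rotated]) simp
    also have "\<dots> \<le> 2" by (simp add: card_insert_le_m1)
    finally show False using lab by simp
  qed
  then obtain i where i: "label G (E i) \<noteq> label G (E (Suc (Suc i)))" ..
  \<comment> \<open>This shift moves \<open>E i\<close>, \<open>E (Suc i)\<close>,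
    \<open>E (Suc (Suc i))\<close> to the positions \<open>m - 1\<close>, \<open>m\<close>,
    \<open>1\<close>.\<close>
  define w where "w j = v ((j + (i + 2)) mod m)" for j
  have wo: "cyclic_order m G w" unfolding w_def using vo m(2) by (rule cyclic_order_rotate)
  have "\<exists>a. label G {w (j - 1), w j} = principal_ideal (sq_form a)" if "j \<in> {1..m}" for j
    using assms(1) wo that by (auto simp: sq_cycle_def cyclic_order_def)
  then obtain a where a: "\<And>j. j \<in> {1..m} \<Longrightarrow> label G {w (j - 1), w j} = principal_ideal (sq_form (a j))"
    by metis
  have w_E: "{w (j - 1), w j} = E (j + i + 1)" if "j \<ge> 1" for j
    using that by (simp add: w_def E_def)
  have E_add: "E (m + j) = E j" for j by (metis E_mod mod_add_self1)
  have "{w (m - 1 - 1), w (m - 1)} = E (m + i)" "{w (m - 1), w m} = E (m + Suc i)" "{w 0, w 1} = E (Suc (Suc i))"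
    using w_E[of "m - 1"] w_E[of m] w_E[of 1] m by (simp_all add: algebra_simps)
  then have "principal_ideal (sq_form (a (m - 1))) = label G (E i)"
    "principal_ideal (sq_form (a m)) = label G (E (Suc i))"
    "principal_ideal (sq_form (a 1)) = label G (E (Suc (Suc i)))"
    using a[of "m - 1"] a[of m] a[of 1] m unfolding E_add by auto
  then have "distinct [a (m - 1), a m, a 1]"
    using step[of i] step[of "Suc i"] i by auto
  then have "good_order m G w a" using wo a by (simp add: good_order_def)
  then show ?thesis by blast
qed

section \<open>Reinsertion of vertices\<close>

text \<open>Copying the entry at \<open>u\<close> to \<open>x\<close> is a linear map.\<close>

lemma span_fun_upd:
  fixes b :: "'v \<Rightarrow> 'r::comm_ring_1"
  assumes "b \<in> coordwise.span B"
  shows "b(x := b u) \<in> coordwise.span ((\<lambda>b. b(x := b u)) ` B)"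
  using assms
proof (induction rule: coordwise.span_induct_alt)
  case base
  have "(0 :: 'v \<Rightarrow> 'r)(x := 0 u) = 0" by (simp add: fun_eq_iff)
  then show ?case by (simp only: coordwise.span_zero)
next
  case (step c y z)
  have "(scale_coordwise c y + z)(x := (scale_coordwise c y + z) u) =
      scale_coordwise c (y(x := y u)) + z(x := z u)"
    by (simp add: fun_eq_iff scale_coordwise_def)
  moreover have "y(x := y u) \<in> (\<lambda>b. b(x := b u)) ` B"
    using step(1) by blast
  ultimately show ?case
    using step(2) by (simp only: coordwise.span_add coordwise.span_scale coordwise.span_base)
qed

lemma generates_splines_reinsert:
  fixes G :: "('v, 'r::comm_ring_1) labeled_graph"
  assumes elim: "eliminates G x u w (principal_ideal s) G'"
    and lab: "\<And>e. e \<in> edges G \<Longrightarrow> \<exists>s. label G e = principal_ideal s"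
    and x: "x \<in> verts G" "u \<in> verts G" "w \<in> verts G" "u \<noteq> x" "w \<noteq> x" "{u, w} \<notin> edges G"
    and inc: "\<And>e. e \<in> edges G \<Longrightarrow> x \<in> e \<Longrightarrow> e = {u, x} \<or> e = {x, w}"
    and u': "u' \<in> {u, w}"
    and gen: "generates_splines G' B"
  shows "generates_splines G (insert (unit_vector x s) ((\<lambda>b. b(x := b u')) ` B))" (is "generates_splines G ?B")
proof -
  have uw: "{u, x} \<in> edges G" "{x, w} \<in> edges G" "label G {u, x} = principal_ideal s" "label G {x, w} = principal_ideal s"
    and G': "verts G' = verts G - {x}" "edges G' = insert {u, w} (edges G - {{u, x}, {x, w}})"
      "label G' = (label G)({u, w} := principal_ideal s)"
    using elim by (auto simp: eliminates_def)
  have sub: "coordwise.subspace (splines G)" using lab by (rule subspace_splines_principal)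
  have extend: "b(x := b u') \<in> splines G" if b: "b \<in> splines G'" for b
  proof -
    \<comment> \<open>The label of the edge \<open>{u, w}\<close> in \<open>G'\<close> supplies the
      condition at the neighbor of \<open>x\<close> whose entry is not copied.\<close>
    have uw_b: "s dvd b u - b w" "s dvd b w - b u"
      using splines_diff_edge[OF b, of u w] splines_diff_edge[OF b, of w u]
      by (simp_all add: G' insert_commute mem_principal_ideal)
    have "(b(x := b u')) p - (b(x := b u')) q \<in> label G {p, q}" if pq: "{p, q} \<in> edges G" for p q
    proof (cases "x \<in> {p, q}")
      case True
      then have pq': "{p, q} = {u, x} \<or> {p, q} = {x, w}" using inc pq by blast
      then have "p = x \<and> q \<in> {u, w} \<or> q = x \<and> p \<in> {u, w}"
        by (auto simp: doubleton_eq_iff)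
      moreover have l: "label G {p, q} = principal_ideal s"
        using pq' uw(3,4) by metis
      ultimately show ?thesis
        using u' x uw_b unfolding l mem_principal_ideal by auto
    next
      case False
      have "{p, q} \<noteq> {u, w}" "{p, q} \<noteq> {u, x}" "{p, q} \<noteq> {x, w}"
        using pq x(6) False by (metis, blast, blast)
      then have e: "{p, q} \<in> edges G'" and l: "label G' {p, q} = label G {p, q}"
        using pq unfolding G' by (simp_all only: insert_iff Diff_iff empty_iff fun_upd_other simp_thms)
      have "b p - b q \<in> label G {p, q}" using splines_diff_edge[OF b e] unfolding l .
      moreover have "(b(x := b u')) p = b p" "(b(x := b u')) q = b q" using False by auto
      ultimately show ?thesis by simp
    qed
    moreover have "(b(x := b u')) z = 0" if "z \<notin> verts G" for z
      using b that x(1) by (auto simp: splines_def G')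
    ultimately show ?thesis by (simp add: splines_def)
  qed
  have unit: "scale_coordwise r (unit_vector x s) \<in> splines G" for r
  proof -
    have "unit_vector x s \<in> splines G"
      unfolding splines_def
    proof (intro CollectI conjI allI impI)
      fix p q assume pq: "{p, q} \<in> edges G"
      show "unit_vector x s p - unit_vector x s q \<in> label G {p, q}"
      proof (cases "x \<in> {p, q}")
        case True
        then have "label G {p, q} = principal_ideal s" using inc[OF pq True] uw(3,4) by metis
        then show ?thesis by (simp add: unit_vector_def mem_principal_ideal)
      next
        case False
        then have "unit_vector x s p - unit_vector x s q = 0" by (auto simp: unit_vector_def)
        moreover obtain t where "label G {p, q} = principal_ideal t" using lab[OF pq] by blast
        ultimately show ?thesis by (simp only: mem_principal_ideal dvd_0_right)
      qed
    qed (use x(1) in \<open>auto simp: unit_vector_def\<close>)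
    then show ?thesis by (rule coordwise.subspace_scale[OF sub])
  qed
  have "?B \<subseteq> splines G"
    using extend unit[of 1] gen by (auto simp: generates_splines_def)
  moreover have "p \<in> coordwise.span ?B" if p: "p \<in> splines G" for p
  proof -
    have ux: "s dvd p u - p x" "s dvd p x - p w" "s dvd p x - p u" "s dvd p w - p x"
      using splines_diff_edge[OF p, of u x] splines_diff_edge[OF p, of x u]
        splines_diff_edge[OF p, of x w] splines_diff_edge[OF p, of w x] uw
      by (simp_all add: insert_commute mem_principal_ideal)
    \<comment> \<open>Vectors vanish outside the vertex set, so restricting \<open>p\<close> to
      \<open>G'\<close> means zero at \<open>x\<close>. Across the new edge the two divisibilities
      through \<open>x\<close> add up.\<close>
    have "p(x := 0) \<in> splines G'"
      unfolding splines_def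
    proof (intro CollectI conjI allI impI)
      fix y z assume yz: "{y, z} \<in> edges G'"
      show "(p(x := 0)) y - (p(x := 0)) z \<in> label G' {y, z}"
      proof (cases "{y, z} = {u, w}")
        case True
        then have "y = u \<and> z = w \<or> y = w \<and> z = u" by (auto simp: doubleton_eq_iff)
        moreover have "s dvd p u - p w" "s dvd p w - p u"
          using dvd_add[OF ux(1,2)] dvd_add[OF ux(4,3)] by simp_all
        moreover have "label G' {y, z} = principal_ideal s" unfolding G' True by simp
        ultimately show ?thesis using x(4,5) by (auto simp: mem_principal_ideal)
      next
        case False
        then have yz': "{y, z} \<in> edges G" "{y, z} \<noteq> {u, x}" "{y, z} \<noteq> {x, w}"
          using yz unfolding G' by blast+
        then have "y \<noteq> x" "z \<noteq> x" using inc[OF yz'(1)] by blast+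
        moreover have "label G' {y, z} = label G {y, z}" using False unfolding G' by (rule fun_upd_other)
        ultimately show ?thesis using splines_diff_edge[OF p yz'(1)] by simp
      qed
    qed (use p in \<open>auto simp: splines_def G'\<close>)
    then have "p(x := 0) \<in> coordwise.span B" using gen by (simp add: generates_splines_def)
    then have "(p(x := 0))(x := (p(x := 0)) u') \<in> coordwise.span ((\<lambda>b. b(x := b u')) ` B)"
      by (rule span_fun_upd)
    then have base: "p(x := p u') \<in> coordwise.span ?B"
      using u' x(4,5) by (auto intro: coordwise.span_mono[THEN subsetD, OF subset_insertI])
    \<comment> \<open>The true entry at \<open>x\<close> and the copied one differ by a multiple of
      \<open>s\<close>, which the new generator corrects.\<close>
    obtain r where r: "p x - p u' = s * r" using u' ux by (auto elim: dvdE)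
    have "p = p(x := p u') + scale_coordwise r (unit_vector x s)"
      using r by (auto simp: fun_eq_iff scale_coordwise_def unit_vector_def algebra_simps)
    moreover have "\<dots> \<in> coordwise.span ?B"
      by (intro coordwise.span_add[OF base] coordwise.span_scale coordwise.span_base insertI1)
    ultimately show ?thesis by simp
  qed
  ultimately show ?thesis
    using coordwise.span_minimal[OF _ sub] unfolding generates_splines_def by blast
qed

text \<open>A reinsertion adds one vertex and at most one generator, so the cardinality stays
  bounded by the length of the cycle; a copied entry has the degree of its source.\<close>

lemma reinsertions_generate:
  fixes G :: "('v, 'k::field poly poly) labeled_graph"
  assumes "eliminations G es Gm" "sq_cycle n G" "reinsertions es B0 B"
    and "generates_splines Gm B0" "finite B0" "card B0 \<le> n - length es" "homogeneous_vectors (verts Gm) B0"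
  shows "generates_splines G B \<and> finite B \<and> card B \<le> n \<and> homogeneous_vectors (verts G) B"
  using assms
proof (induction arbitrary: n B rule: eliminations.induct)
  case (1 G)
  from 1(2) have "B = B0" by cases
  then show ?case using 1 by simp
next
  case (2 G x u w I G' es G'')
  note step = sq_cycle_eliminates[OF "2.prems"(1) "2.hyps"(1)]
  from "2.prems"(2) obtain u' a B1 where re: "reinsertions es B0 B1" "u' \<in> {u, w}" "I = principal_ideal (sq_form a)"
    and B: "B = insert (\<lambda>z. if z = x then sq_form a else 0) ((\<lambda>b. b(x := b u')) ` B1)"
    by cases
  have "is_cycle n G" "3 \<le> card (label G ` edges G)" and lab: "\<forall>e\<in>edges G. \<exists>a. label G e = principal_ideal (sq_form a)"
    using "2.prems"(1) by (auto simp: sq_cycle_def)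
  note e = eliminates_cycle[OF this(1,2) "2.hyps"(1)]
  have V: "verts G' = verts G - {x}" using "2.hyps"(1) by (simp add: eliminates_def)
  have IH: "generates_splines G' B1" "finite B1" "card B1 \<le> n - 1" "homogeneous_vectors (verts G') B1"
    using "2.IH"[OF step(1) re(1)] "2.prems" by auto
  have "generates_splines G B"
    unfolding B unit_vector_def[symmetric]
    using lab by (intro generates_splines_reinsert[OF "2.hyps"(1)[unfolded re(3)] _ e(2-8) re(2) IH(1)]) blast+
  moreover have "finite B" using IH(2) by (simp add: B)
  moreover have "card B \<le> n"
    using card_image_le[OF IH(2), of "\<lambda>b. b(x := b u')"] IH(2,3) step(2)
    unfolding B by (intro card_insert_le_m1) auto
  moreover have "homogeneous_vectors (verts G) B"
    unfolding homogeneous_vectors_def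
  proof
    fix b assume "b \<in> B"
    then consider "b = (\<lambda>z. if z = x then sq_form a else 0)" | b1 where "b1 \<in> B1" "b = b1(x := b1 u')"
      unfolding B by blast
    then show "\<exists>d. \<forall>v\<in>verts G. b v \<noteq> 0 \<longrightarrow> homogeneous d (b v)"
    proof cases
      case 1
      then show ?thesis using homogeneous_sq_form by auto
    next
      case 2
      then obtain d where "\<forall>v\<in>verts G'. b1 v \<noteq> 0 \<longrightarrow> homogeneous d (b1 v)"
        using IH(4) unfolding homogeneous_vectors_def by blast
      moreover have "u' \<in> verts G'" using re(2) e V by auto
      ultimately have "\<forall>v\<in>verts G. b v \<noteq> 0 \<longrightarrow> homogeneous d (b v)" using 2(2) V by auto
      then show ?thesis by blast
    qed
  qed
  ultimately show ?case by blast
qed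

lemma reinsertions_exist:
  assumes "eliminations G es Gm" "sq_cycle n G"
  shows "\<exists>B. reinsertions es B0 B"
  using assms
proof (induction arbitrary: n rule: eliminations.induct)
  case (1 G)
  then show ?case by (blast intro: reinsertions.intros)
next
  case (2 G x u w I G' es G'')
  note step = sq_cycle_eliminates[OF "2.prems" "2.hyps"(1)]
  obtain a B where "I = principal_ideal (sq_form a)" "reinsertions es B0 B"
    using step(3) "2.IH"[OF step(1)] by blast
  then show ?case by (blast intro: reinsertions.intros)
qed

section \<open>Generators of a reduced cycle\<close>

lemma vertex_vector_apply:
  assumes "inj_on v {1..m}" "j \<in> {1..m}"
  shows "vertex_vector m v h (v j) = h j"
proof -
  have "{i. i \<in> {1..m} \<and> v i = v j} = {j}" using assms by (blast dest: inj_onD)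
  then show ?thesis by (simp add: vertex_vector_def)
qed

lemma vertex_vector_outside: "z \<notin> v ` {1..m} \<Longrightarrow> vertex_vector m v h z = 0"
  unfolding vertex_vector_def by (rule sum.neutral) blast

lemma good_coeffs_exist:
  fixes a :: "nat \<Rightarrow> 'k::field"
  assumes "distinct [a (m - 1), a m, a 1]" "m \<ge> 3"
  shows "\<exists>c f g. good_coeffs m a c f g"
proof -
  have "\<exists>c1 c2 c3. sq_form (a i) = const2 c1 * sq_form (a (m - 1)) + const2 c2 * sq_form (a m) + const2 c3 * sq_form (a 1)" for i
    using assms(1) by (rule sq_form_interpolation)
  then obtain c1 c2 c3 where c: "\<And>i. sq_form (a i) =
      const2 (c1 i) * sq_form (a (m - 1)) + const2 (c2 i) * sq_form (a m) + const2 (c3 i) * sq_form (a 1)"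
    by metis
  have "a m \<noteq> a 1" using assms(1) by simp
  then obtain f1 g1 f2 g2 where fg:
    "homogeneous 1 f1" "homogeneous 1 g1" "homogeneous 1 f2" "homogeneous 1 g2"
    "var_x * sq_form (a (m - 1)) = f1 * sq_form (a m) + g1 * sq_form (a 1)"
    "var_y * sq_form (a (m - 1)) = f2 * sq_form (a m) + g2 * sq_form (a 1)"
    by (rule syzygy_exists)
  \<comment> \<open>The indices \<open>m - 1\<close>, \<open>m\<close>, \<open>1\<close> differ
    because \<open>m \<ge> 3\<close>, so each scalar gets its own slot.\<close>
  have "good_coeffs m a (\<lambda>i j. if j = m - 1 then c1 i else if j = m then c2 i else c3 i)
      (\<lambda>i. if i = 1 then f1 else f2) (\<lambda>i. if i = 1 then g1 else g2)"
    unfolding good_coeffs_def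
  proof (intro conjI allI impI)
    fix i
    have "1 \<noteq> m - 1" "1 \<noteq> m" "m \<noteq> m - 1" using assms(2) by auto
    then show "sq_form (a i) =
        const2 (if m - 1 = m - 1 then c1 i else if m - 1 = m then c2 i else c3 i) * sq_form (a (m - 1)) +
        const2 (if m = m - 1 then c1 i else if m = m then c2 i else c3 i) * sq_form (a m) +
        const2 (if 1 = m - 1 then c1 i else if 1 = m then c2 i else c3 i) * sq_form (a 1)"
      using c[of i] by (simp only: if_True if_False refl)
  qed (use fg in simp_all)
  then show ?thesis by blast
qed

locale ordered_sq_cycle =
  fixes m :: nat and G :: "('v, 'k::field poly poly) labeled_graph" and v :: "nat \<Rightarrow> 'v"
    and a :: "nat \<Rightarrow> 'k" and c :: "nat \<Rightarrow> nat \<Rightarrow> 'k" and f g :: "nat \<Rightarrow> 'k poly poly"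
  assumes char: "CHAR('k) \<noteq> 2" and m: "m \<ge> 3"
    and good_order: "good_order m G v a" and good_coeffs: "good_coeffs m a c f g"
begin

abbreviation A :: "nat \<Rightarrow> 'k poly poly" where "A i \<equiv> sq_form (a i)"
abbreviation low :: "nat \<Rightarrow> 'v \<Rightarrow> 'k poly poly" where "low i \<equiv> low_spline m v a c i"
abbreviation high_x :: "'v \<Rightarrow> 'k poly poly" where "high_x \<equiv> high_spline m v a var_x (g 1)"
abbreviation high_y :: "'v \<Rightarrow> 'k poly poly" where "high_y \<equiv> high_spline m v a var_y (g 2)"
abbreviation mgs :: "('v \<Rightarrow> 'k poly poly) set" where "mgs \<equiv> reduced_mgs m G v a c g"

lemma order: "v 0 = v m" "inj_on v {1..m}" "verts G = v ` {1..m}" "edges G = (\<lambda>i. {v (i - 1), v i}) ` {1..m}"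
  and labels: "\<And>i. i \<in> {1..m} \<Longrightarrow> label G {v (i - 1), v i} = principal_ideal (A i)"
  and distinct: "distinct [a (m - 1), a m, a 1]"
  using good_order by (auto simp: good_order_def cyclic_order_def bij_betw_def)

text \<open>Ideals are closed under negation, so one orientation of each edge suffices. For
  \<open>i = 1\<close> the predecessor is \<open>v 0 = v m\<close>.\<close>

lemma mem_splines_iff:
  "p \<in> splines G \<longleftrightarrow> (\<forall>z. z \<notin> verts G \<longrightarrow> p z = 0) \<and> (\<forall>i\<in>{1..m}. A i dvd p (v i) - p (v (i - 1)))"
    (is "_ \<longleftrightarrow> ?R")
proof
  assume p: "p \<in> splines G"
  have "A i dvd p (v i) - p (v (i - 1))" if i: "i \<in> {1..m}" for i
  proof -
    have e: "{v i, v (i - 1)} \<in> edges G" using i order(4) by (simp add: insert_commute)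
    show ?thesis
      using splines_diff_edge[OF p e] labels[OF i] by (simp add: insert_commute mem_principal_ideal)
  qed
  then show ?R using p by (simp add: splines_def)
next
  assume R: ?R
  have "p u - p w \<in> label G {u, w}" if uw: "{u, w} \<in> edges G" for u w
  proof -
    obtain i where i: "i \<in> {1..m}" "{u, w} = {v (i - 1), v i}" using uw order(4) by auto
    have "A i dvd p (v i) - p (v (i - 1))" using R i(1) by blast
    moreover from this have "A i dvd p (v (i - 1)) - p (v i)" by (rule dvd_diff_swap)
    moreover have "u = v (i - 1) \<and> w = v i \<or> u = v i \<and> w = v (i - 1)"
      using i(2) by (auto simp: doubleton_eq_iff)
    ultimately show ?thesis unfolding i(2) labels[OF i(1)] mem_principal_ideal by metis
  qed
  then show "p \<in> splines G" using R by (simp add: splines_def)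
qed

lemma splines_eqI:
  assumes "p \<in> splines G" "q \<in> splines G" "\<And>j. j \<in> {1..m} \<Longrightarrow> p (v j) = q (v j)"
  shows "p = q"
proof
  fix z
  show "p z = q z"
    using assms order(3) by (cases "z \<in> verts G") (auto simp: splines_def)
qed

lemma subspace: "coordwise.subspace (splines G)"
proof (rule subspace_splines_principal)
  fix e assume "e \<in> edges G"
  then show "\<exists>s. label G e = principal_ideal s" using order(4) labels by auto
qed

section \<open>The listed vectors are splines\<close>

lemma low_at:
  assumes "1 < i" "i \<le> m - 2" "j \<in> {1..m}"
  shows "low i (v j) = (if j < i then 0 else if j \<le> m - 2 then A i
     else if j = m - 1 then A i - const2 (c i (m - 1)) * A (m - 1) else const2 (c i 1) * A 1)"
proof -
  have "A i = const2 (c i (m - 1)) * A (m - 1) + const2 (c i m) * A m + const2 (c i 1) * A 1"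
    using good_coeffs assms(1,2) by (simp add: good_coeffs_def)
  \<comment> \<open>The entry at \<open>v m\<close> becomes a multiple of \<open>A 1\<close>, as the
    edge back to \<open>v 1\<close> demands.\<close>
  then have "A i - const2 (c i (m - 1)) * A (m - 1) - const2 (c i m) * A m = const2 (c i 1) * A 1"
    by (metis (no_types, lifting) add_diff_cancel_left' diff_diff_add)
  then show ?thesis
    using assms by (simp add: low_spline_def vertex_vector_apply[OF order(2)])
qed

lemma high_at:
  assumes "j \<in> {1..m}"
  shows "high_spline m v a t h (v j) =
    (if j \<le> m - 2 then 0 else if j = m - 1 then t * A (m - 1) else h * A 1)"
  using assms by (simp add: high_spline_def vertex_vector_apply[OF order(2)])

lemma low_diff:
  assumes "1 < i" "i \<le> m - 2"
  shows "A i - const2 (c i (m - 1)) * A (m - 1) - const2 (c i 1) * A 1 = const2 (c i m) * A m"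
proof -
  have "A i = const2 (c i (m - 1)) * A (m - 1) + const2 (c i m) * A m + const2 (c i 1) * A 1"
    using good_coeffs assms by (simp add: good_coeffs_def)
  then show ?thesis by (simp add: algebra_simps)
qed

text \<open>Around the cycle the vector jumps by \<open>A i\<close> at edge \<open>i\<close> and by
  scalar multiples of \<open>A (m - 1)\<close>, \<open>A m\<close>, \<open>A 1\<close> at the edges
  \<open>m - 1\<close>, \<open>m\<close>, \<open>1\<close>; the relation for \<open>A i\<close>
  makes the jumps sum to zero.\<close>

lemma low_splines:
  assumes i: "1 < i" "i \<le> m - 2"
  shows "low i \<in> splines G"
  unfolding mem_splines_iff
proof (intro conjI allI impI ballI)
  fix z assume "z \<notin> verts G"
  then show "low i z = 0" by (simp add: order(3) low_spline_def vertex_vector_outside)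
next
  fix k assume k: "k \<in> {1..m}"
  consider "k = 1" | "2 \<le> k" "k \<le> m - 2" | "k = m - 1" | "k = m" "k \<noteq> 1" using k m by force
  then show "A k dvd low i (v k) - low i (v (k - 1))"
  proof cases
    case 1
    have "low i (v 1) = 0" "low i (v m) = const2 (c i 1) * A 1"
      using low_at[OF i, of 1] low_at[OF i, of m] i m by auto
    then show ?thesis by (simp add: 1 order(1))
  next
    case 2
    then have k': "k - 1 \<in> {1..m}" "k - 1 \<le> m - 2" using k by auto
    have "low i (v k) = (if k < i then 0 else A i)" "low i (v (k - 1)) = (if k - 1 < i then 0 else A i)"
      using low_at[OF i k] low_at[OF i k'(1)] 2 k'(2) by auto
    \<comment> \<open>On this stretch the only nonzero jump is the one at edge
      \<open>i\<close>.\<close>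
    moreover have "k = i" if "\<not> k < i" "k - 1 < i" using that 2 by simp
    ultimately show ?thesis using 2 by (cases "k < i"; cases "k - 1 < i") auto
  next
    case 3
    have "low i (v (m - 1)) = A i - const2 (c i (m - 1)) * A (m - 1)" "low i (v (m - 1 - 1)) = A i"
      using low_at[OF i, of "m - 1"] low_at[OF i, of "m - 2"] i m by (auto simp: numeral_2_eq_2)
    then show ?thesis by (simp add: 3)
  next
    case 4
    have "low i (v (m - 1)) = A i - const2 (c i (m - 1)) * A (m - 1)" "low i (v m) = const2 (c i 1) * A 1"
      using low_at[OF i, of "m - 1"] low_at[OF i, of m] i m by auto
    then have "low i (v (m - 1)) - low i (v m) = const2 (c i m) * A m" using low_diff[OF i] by simp
    then have "A m dvd low i (v (m - 1)) - low i (v m)" by simp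
    then show ?thesis unfolding 4(1) by (rule dvd_diff_swap)
  qed
qed

text \<open>The nonzero jumps are confined to the edges \<open>m - 1\<close>, \<open>m\<close>,
  \<open>1\<close>, with values \<open>t * A (m - 1)\<close>, \<open>- h' * A m\<close>,
  \<open>- h * A 1\<close>; the hypothesis says that they sum to zero.\<close>

lemma high_splines:
  assumes "t * A (m - 1) = h' * A m + h * A 1"
  shows "high_spline m v a t h \<in> splines G" (is "?H \<in> _")
  unfolding mem_splines_iff
proof (intro conjI allI impI ballI)
  fix z assume "z \<notin> verts G"
  then show "?H z = 0" by (simp add: order(3) high_spline_def vertex_vector_outside)
next
  fix k assume k: "k \<in> {1..m}"
  have ends: "?H (v 1) = 0" "?H (v (m - 2)) = 0" "?H (v (m - 1)) = t * A (m - 1)" "?H (v m) = h * A 1"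
    using high_at[of 1] high_at[of "m - 2"] high_at[of "m - 1"] high_at[of m] m by auto
  consider "k = 1" | "2 \<le> k" "k \<le> m - 2" | "k = m - 1" | "k = m" "k \<noteq> 1" using k m by force
  then show "A k dvd ?H (v k) - ?H (v (k - 1))"
  proof cases
    case 1
    then show ?thesis by (simp add: ends order(1) del: One_nat_def)
  next
    case 2
    then have "k - 1 \<in> {1..m}" "k - 1 \<le> m - 2" using k by auto
    then show ?thesis using 2 by (simp only: high_at[OF k] high_at if_True diff_self dvd_0_right)
  next
    case 3
    then show ?thesis by (simp add: ends del: One_nat_def)
  next
    case 4
    have "?H (v (m - 1)) - ?H (v m) = h' * A m" using assms by (simp add: ends del: One_nat_def)
    then have "A m dvd ?H (v (m - 1)) - ?H (v m)" by simp
    then show ?thesis unfolding 4(1) by (rule dvd_diff_swap)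
  qed
qed

lemma coeffs:
  "homogeneous 1 (f 1)" "homogeneous 1 (g 1)" "homogeneous 1 (f 2)" "homogeneous 1 (g 2)"
  "var_x * A (m - 1) = f 1 * A m + g 1 * A 1" "var_y * A (m - 1) = f 2 * A m + g 2 * A 1"
  using good_coeffs by (auto simp: good_coeffs_def)

lemma high_x_splines: "high_x \<in> splines G" and high_y_splines: "high_y \<in> splines G"
  using high_splines coeffs(5,6) by blast+

lemma trivial_splines: "trivial_spline G \<in> splines G"
  unfolding mem_splines_iff
proof (intro conjI allI impI ballI)
  fix i assume i: "i \<in> {1..m}"
  then have "v (i - 1) \<in> verts G"
    using order(1,3) m by (cases "i = 1") (auto intro!: imageI simp del: One_nat_def)
  then show "A i dvd trivial_spline G (v i) - trivial_spline G (v (i - 1))"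
    using i order(3) by (simp add: trivial_spline_def)
qed (simp add: trivial_spline_def)

lemma mgs_subset: "mgs \<subseteq> splines G"
  using low_splines high_x_splines high_y_splines trivial_splines by (auto simp: reduced_mgs_def)

section \<open>Generation by clearing entries one after another\<close>

lemma mgs_in_span: "trivial_spline G \<in> coordwise.span mgs" "high_x \<in> coordwise.span mgs" "high_y \<in> coordwise.span mgs"
  "1 < i \<Longrightarrow> i \<le> m - 2 \<Longrightarrow> low i \<in> coordwise.span mgs"
  by (auto intro!: coordwise.span_base simp: reduced_mgs_def)

lemma spline_last_in_span:
  assumes q: "q \<in> splines G" and z: "\<And>j. 1 \<le> j \<Longrightarrow> j \<le> m - 1 \<Longrightarrow> q (v j) = 0"
  shows "q \<in> coordwise.span mgs"
proof -
  have dvd: "A i dvd q (v i) - q (v (i - 1))" if "i \<in> {1..m}" for i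
    using q that unfolding mem_splines_iff by blast
  have "A 1 dvd q (v m)" using dvd[of 1] z[of 1] m by (simp add: order(1))
  then obtain s where s: "q (v m) = s * A 1" by (rule dvdE_right)
  have "A m dvd s * A 1" using dvd[of m] z[of "m - 1"] m by (simp add: s)
  moreover have "a 1 \<noteq> a m" using distinct by auto
  ultimately have "A m dvd s" by (rule sq_form_dvd_cancel[rotated])
  then obtain e where e: "s = e * A m" by (rule dvdE_right)
  obtain d where d: "d \<noteq> 0" "var_y * g 1 - var_x * g 2 = const2 d * A m"
    using syzygy[OF char distinct coeffs] .
  define r where "r = e * const2 (inverse d)"
  have r: "r * const2 d = e" using d(1) by (simp add: r_def const2_def flip: one_pCons)
  \<comment> \<open>At \<open>v (m - 1)\<close> the two terms cancel. At \<open>v m\<close> the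
    syzygy leaves \<open>r * const2 d * A m * A 1\<close>, and \<open>r\<close> absorbs the constant
    so that this is the given entry.\<close>
  let ?q = "scale_coordwise (r * var_y) high_x - scale_coordwise (r * var_x) high_y"
  have span: "?q \<in> coordwise.span mgs"
    by (intro coordwise.span_diff coordwise.span_scale mgs_in_span)
  have "q = ?q"
  proof (rule splines_eqI)
    show "?q \<in> splines G"
      by (intro coordwise.subspace_diff[OF subspace] coordwise.subspace_scale[OF subspace] high_x_splines high_y_splines)
    fix j assume j: "j \<in> {1..m}"
    consider "j \<le> m - 2" | "j = m - 1" | "j = m" using j m by force
    then show "q (v j) = ?q (v j)"
    proof cases
      case 1
      then show ?thesis using j z[of j] by (simp add: scale_coordwise_def high_at)
    next
      case 2
      then show ?thesis using j z[of j] m by (simp add: scale_coordwise_def high_at)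
    next
      case 3
      have "m \<in> {1..m}" "\<not> m \<le> m - 2" "m \<noteq> m - 1" using m by auto
      then have "?q (v m) = r * (var_y * g 1 - var_x * g 2) * A 1"
        by (simp add: scale_coordwise_def high_at algebra_simps)
      also have "\<dots> = q (v m)" unfolding d(2) s e r[symmetric] by (simp only: mult.assoc)
      finally show ?thesis using 3 by simp
    qed
  qed (rule q)
  then show ?thesis using span by simp
qed

lemma spline_last_two_in_span:
  assumes p: "p \<in> splines G" and z: "\<And>j. 1 \<le> j \<Longrightarrow> j \<le> m - 2 \<Longrightarrow> p (v j) = 0"
  shows "p \<in> coordwise.span mgs"
proof -
  have dvd: "A i dvd p (v i) - p (v (i - 1))" if "i \<in> {1..m}" for i
    using p that unfolding mem_splines_iff by blast
  have "A (m - 1) dvd p (v (m - 1))"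
    using dvd[of "m - 1"] z[of "m - 1 - 1"] m by simp
  then obtain r where r: "p (v (m - 1)) = r * A (m - 1)" by (rule dvdE_right)
  have "A 1 dvd p (v m)" using dvd[of 1] z[of 1] m by (simp add: order(1))
  then obtain s where s: "p (v m) = s * A 1" by (rule dvdE_right)
  obtain t where "p (v m) - p (v (m - 1)) = A m * t" using dvd[of m] m by (auto elim: dvdE)
  \<comment> \<open>Both conditions on the entry at \<open>v m\<close>, from edges \<open>m\<close>
    and \<open>1\<close>, are merged into one relation between three squares; independence then
    removes the constant term of \<open>r\<close>.\<close>
  then have "r * A (m - 1) = (- t) * A m + s * A 1" unfolding r s by (simp add: algebra_simps)
  then have "coeff (coeff r 0) 0 = 0" by (rule sq_forms_independent[OF char distinct])
  then obtain r1 r2 where r12: "r = r1 * var_x + r2 * var_y" by (rule in_maximal_ideal)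
  let ?h = "scale_coordwise r1 high_x + scale_coordwise r2 high_y"
  have "?h \<in> splines G"
    by (intro coordwise.subspace_add[OF subspace] coordwise.subspace_scale[OF subspace] high_x_splines high_y_splines)
  then have "p - ?h \<in> splines G" by (rule coordwise.subspace_diff[OF subspace p])
  then have "p - ?h \<in> coordwise.span mgs"
  proof (rule spline_last_in_span)
    fix j assume j: "1 \<le> j" "j \<le> m - 1"
    then consider "j \<le> m - 2" | "j = m - 1" by force
    then show "(p - ?h) (v j) = 0"
    proof cases
      case 1
      then show ?thesis using j z[of j] by (simp add: scale_coordwise_def high_at)
    next
      case 2
      then show ?thesis using m by (simp add: scale_coordwise_def high_at r[unfolded r12] algebra_simps del: One_nat_def)
    qed
  qed
  moreover have "?h \<in> coordwise.span mgs"
    by (intro coordwise.span_add coordwise.span_scale mgs_in_span)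
  ultimately have "(p - ?h) + ?h \<in> coordwise.span mgs" by (rule coordwise.span_add)
  then show ?thesis by simp
qed

text \<open>Induction from \<open>k = m - 2\<close> downwards: clearing one further entry turns the
  case \<open>k\<close> into the case \<open>Suc k\<close>.\<close>

lemma spline_vanishing_in_span:
  assumes "k \<le> m - 2" "1 \<le> k" "p \<in> splines G" "\<And>j. 1 \<le> j \<Longrightarrow> j \<le> k \<Longrightarrow> p (v j) = 0"
  shows "p \<in> coordwise.span mgs"
  using assms
proof (induction k arbitrary: p rule: inc_induct)
  case base
  then show ?case by (intro spline_last_two_in_span)
next
  case (step k)
  have i: "1 < Suc k" "Suc k \<le> m - 2" using step by auto
  have "Suc k \<in> {1..m}" using i by simp
  then have "A (Suc k) dvd p (v (Suc k)) - p (v (Suc k - 1))"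
    using step.prems(2) unfolding mem_splines_iff by blast
  then have "A (Suc k) dvd p (v (Suc k))" using step.prems by simp
  then obtain r where r: "p (v (Suc k)) = r * A (Suc k)" by (rule dvdE_right)
  \<comment> \<open>This vector is zero at \<open>v 1\<close> to \<open>v k\<close>, so the entries
    already cleared stay zero.\<close>
  let ?h = "scale_coordwise r (low (Suc k))"
  have "p - ?h \<in> coordwise.span mgs"
  proof (rule step.IH)
    show "p - ?h \<in> splines G"
      by (intro coordwise.subspace_diff[OF subspace] coordwise.subspace_scale[OF subspace] low_splines i step.prems)
    fix j assume j: "1 \<le> j" "j \<le> Suc k"
    then show "(p - ?h) (v j) = 0"
      using step.prems(3)[of j] i by (cases "j = Suc k") (auto simp: scale_coordwise_def low_at r)
  qed simp
  moreover have "?h \<in> coordwise.span mgs"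
    by (intro coordwise.span_scale mgs_in_span i)
  ultimately have "(p - ?h) + ?h \<in> coordwise.span mgs" by (rule coordwise.span_add)
  then show ?case by simp
qed

lemma mgs_generates: "generates_splines G mgs"
proof -
  have "p \<in> coordwise.span mgs" if p: "p \<in> splines G" for p
  proof -
    \<comment> \<open>The trivial spline clears the entry at \<open>v 1\<close>, which starts the
      process at \<open>k = 1\<close>.\<close>
    let ?h = "scale_coordwise (p (v 1)) (trivial_spline G)"
    have "p - ?h \<in> coordwise.span mgs"
    proof (rule spline_vanishing_in_span[of 1])
      show "p - ?h \<in> splines G"
        by (intro coordwise.subspace_diff[OF subspace] coordwise.subspace_scale[OF subspace] trivial_splines p)
      fix j :: nat assume "1 \<le> j" "j \<le> 1"
      then show "(p - ?h) (v j) = 0"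
        using order(3) m by (auto simp: scale_coordwise_def trivial_spline_def)
    qed (use m in auto)
    moreover have "?h \<in> coordwise.span mgs"
      by (intro coordwise.span_scale mgs_in_span)
    ultimately have "(p - ?h) + ?h \<in> coordwise.span mgs" by (rule coordwise.span_add)
    then show ?thesis by simp
  qed
  then show ?thesis
    using mgs_subset coordwise.span_minimal[OF mgs_subset subspace] by (auto simp: generates_splines_def)
qed

section \<open>Size and degrees of the generators\<close>

lemma mgs_card: "finite mgs" "card mgs \<le> m"
proof -
  have eq: "mgs = insert (trivial_spline G) (insert high_x (insert high_y (low ` {2..m - 2})))"
    by (auto simp: reduced_mgs_def)
  show "finite mgs" unfolding eq by simp
  \<comment> \<open>With the trivial spline and two high splines this makes at most
    \<open>m\<close>; for \<open>m = 3\<close> there are no low splines.\<close>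
  have "card (low ` {2..m - 2}) \<le> m - 3"
    using card_image_le[of "{2..m - 2}" low] by simp
  then show "card mgs \<le> m"
    unfolding eq using m by (intro card_insert_le_m1) auto
qed

text \<open>The degrees are 0 for the trivial spline, 2 for the low splines and 3 for the high
  ones.\<close>

lemma mgs_homogeneous: "homogeneous_vectors (verts G) mgs"
proof -
  have hom_scale: "homogeneous 2 (const2 b * A j)" for b j
    using homogeneous_mult[OF homogeneous_const2 homogeneous_sq_form] by (simp only: add_0)
  have hom_high: "homogeneous 3 (h * A j)" if "homogeneous 1 h" for h j
    using homogeneous_mult[OF that homogeneous_sq_form, of "a j"] by (simp add: eval_nat_numeral)
  have high: "\<forall>z\<in>verts G. high_spline m v a t h z \<noteq> 0 \<longrightarrow> homogeneous 3 (high_spline m v a t h z)"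
    if "homogeneous 1 t" "homogeneous 1 h" for t h
    unfolding order(3) using hom_high that by (auto simp: high_at)
  have "\<exists>d. \<forall>z\<in>verts G. b z \<noteq> 0 \<longrightarrow> homogeneous d (b z)" if b: "b \<in> mgs" for b
  proof -
    consider "b = trivial_spline G" | i where "b = low i" "1 < i" "i \<le> m - 2" | "b = high_x" | "b = high_y"
      using b by (auto simp: reduced_mgs_def)
    then show ?thesis
    proof cases
      case 1
      have "homogeneous 0 (1 :: 'k poly poly)"
        using homogeneous_const2[of "1::'k"] by (simp add: const2_def flip: one_pCons)
      then show ?thesis by (auto simp: 1 trivial_spline_def)
    next
      case 2
      have "homogeneous 2 (b z)" if "z \<in> verts G" "b z \<noteq> 0" for z
      proof -
        obtain j where j: "j \<in> {1..m}" "z = v j" using \<open>z \<in> verts G\<close> order(3) by blast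
        show ?thesis
          using \<open>b z \<noteq> 0\<close> hom_scale homogeneous_sq_form homogeneous_diff[OF homogeneous_sq_form hom_scale]
          unfolding 2(1) j(2) low_at[OF 2(2,3) j(1)] by (auto split: if_splits)
      qed
      then show ?thesis by blast
    next
      case 3
      then show ?thesis using high[OF homogeneous_vars(1) coeffs(2)] by blast
    next
      case 4
      then show ?thesis using high[OF homogeneous_vars(2) coeffs(4)] by blast
    qed
  qed
  then show ?thesis by (simp add: homogeneous_vectors_def)
qed

end

theorem theorem4p15:
  fixes C :: "('v, 'k::field poly poly) labeled_graph" and n :: nat
  assumes "CHAR('k) \<noteq> 2"
    and "is_cycle n C"
    and "\<And>e. e \<in> edges C \<Longrightarrow> \<exists>a. a \<noteq> 0 \<and> label C e = principal_ideal (sq_form a)"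
    and "card (label C ` edges C) \<ge> 3"
  shows
    "(\<forall>es C'. eliminations C es C' \<longrightarrow> (\<exists>es' Cm. eliminations C' es' Cm \<and> reduced Cm)) \<and>
     (\<forall>es Cm k m. eliminations C es Cm \<and> reduced Cm \<and> k = length es \<and> m = n - k \<longrightarrow>
        is_cycle m Cm \<and>
        (\<exists>v a. good_order m Cm v a) \<and>
        (\<forall>v a. good_order m Cm v a \<longrightarrow>
           (\<exists>c f g. good_coeffs m a c f g) \<and>
           (\<forall>c f g. good_coeffs m a c f g \<longrightarrow>
              homogeneous_mgs Cm (reduced_mgs m Cm v a c g) \<and>
              (\<exists>B. reinsertions es (reduced_mgs m Cm v a c g) B) \<and>
              (\<forall>B. reinsertions es (reduced_mgs m Cm v a c g) B \<longrightarrow> homogeneous_mgs C B))))"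
proof -
  have C: "sq_cycle n C" using assms(2-4) by (auto simp: sq_cycle_def)
  \<comment> \<open>Minimality on \<open>Cm\<close> and on \<open>C\<close> comes from the same
    count: no more generators than vertices.\<close>
  have mgsI: "homogeneous_mgs G B"
    if "sq_cycle l G" "generates_splines G B \<and> finite B \<and> card B \<le> l \<and> homogeneous_vectors (verts G) B"
    for l and G :: "('v, 'k poly poly) labeled_graph" and B
    using that by (intro homogeneous_mgsI[of l]) (auto simp: sq_cycle_def homogeneous_vectors_def)
  show ?thesis
  proof (intro conjI allI impI; (elim conjE)?)
    \<comment> \<open>Eliminations preserve \<open>sq_cycle\<close>, so any partial sequence can be
      continued to a reduced cycle.\<close>
    fix es C' assume "eliminations C es C'"
    then show "\<exists>es' Cm. eliminations C' es' Cm \<and> reduced Cm"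
      using sq_cycle_eliminations[OF _ C] eliminations_to_reduced by blast
  next
    fix es Cm k m
    assume el: "eliminations C es Cm" and red: "reduced Cm" and k: "k = length es" "m = n - k"
    have Cm: "sq_cycle m Cm" using sq_cycle_eliminations[OF el C] k by simp
    then show "is_cycle m Cm" by (simp add: sq_cycle_def)
    then have m3: "m \<ge> 3" by (simp add: is_cycle_def)
    show "\<exists>v a. good_order m Cm v a" using Cm red by (rule good_order_exists)
    fix v a assume go: "good_order m Cm v a"
    then show "\<exists>c f g. good_coeffs m a c f g"
      using m3 by (intro good_coeffs_exist) (auto simp: good_order_def)
    fix c f g assume gc: "good_coeffs m a c f g"
    interpret ordered_sq_cycle m Cm v a c f g
      using assms(1) m3 go gc by unfold_locales
    show "homogeneous_mgs Cm mgs"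
      using mgs_generates mgs_card mgs_homogeneous by (intro mgsI[OF Cm]) blast
    show "\<exists>B. reinsertions es mgs B" using el C by (rule reinsertions_exist)
    fix B assume "reinsertions es mgs B"
    then show "homogeneous_mgs C B"
      using mgs_generates mgs_card mgs_homogeneous k
      by (intro mgsI[OF C] reinsertions_generate[OF el C]) simp_all
  qed
qed

end
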